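(* Let $n\ge1$. The Frobenius characteristic of the $\mathfrak{S}_n$-action on the set of regions of the Shi arrangement $\mathcal{S}_n$ coming from the identification of the regions with parking functions of length $n$ is $G_n(\mathsf{x};1,1,1,0)$.
   Context: The Shi arrangement $\mathcal{S}_n$ is the hyperplane arrangement in $\mathbb{R}^n$ consisting of the hyperplanes $x_i-x_j=0$ and $x_i-x_j=1$ for $1\le i<j\le n$. Its regions are the connected components of the complement of the union of the hyperplanes. A parking function of length $n$ is a sequence $(a_1,\dots,a_n)$ of positive integers whose weakly increasing rearrangement $b_1\le\cdots\le b_n$ satisfies $b_i\le i$ for all $i$. There are known bijections between the regions of $\mathcal{S}_n$ and parking functions of length $n$ (for instance the Pak--Stanley labeling); the $\mathfrak{S}_n$-action on regions is the transport, along such a bijection, of the $\mathfrak{S}_n$-action on parking functions by permuting coordinates. The Frobenius characteristic of an action is that of the corresponding permutation representation. A (plane binary) tree is a rooted tree in which every node has at most one left child and at most one right child (it may have only one of the two), and no other children. A labeled tree is a tree whose nodes are labeled with positive integers, repetitions allowed; $\mathcal{T}^{\ell}_n$ is the set of labeled trees on $n$ nodes. Write $v^\ell$ for the label of $v$. If $v$ is the left child of $w$, the edge is a left ascent if $v^\ell\le w^\ell$ and a left descent otherwise. If $w$ is the right child of $v$, the edge is a right ascent if $v^\ell\le w^\ell$ and a right descent otherwise. $\mathrm{lasc},\mathrm{ldes},\mathrm{rasc},\mathrm{rdes}$ count these edges. With $\mathsf{x}^T=\prod_{v\in T}x_{v^\ell}$, $$G_n(\mathsf{x};\bar\lambda,\lambda,\bar\rho,\rho)=\sum_{T\in\mathcal{T}^\ell_n}\bar\lambda^{\mathrm{lasc}(T)}\lambda^{\mathrm{ldes}(T)}\bar\rho^{\,\mathrm{rasc}(T)}\rho^{\,\mathrm{rdes}(T)}\,\mathsf{x}^T$$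 (with the convention $0^0=1$ when a parameter is set to $0$). *)

theory Defs
  imports
    "HOL-Analysis.Analysis"
    "HOL-Combinatorics.Combinatorics"
    "HOL-Library.Tree_Multiset"
begin

section \<open>Formal power series in infinitely many variables\<close>

text \<open>
  A series in the variables \<open>x\<^sub>1, x\<^sub>2, \<dots>\<close> is given by its coefficients. The monomial
  \<open>x\<^bsub>i\<^sub>1\<^esub> \<cdots> x\<^bsub>i\<^sub>k\<^esub>\<close> is represented by the multiset \<open>{#i\<^sub>1, \<dots>, i\<^sub>k#}\<close>. (The type also has a
  variable with index 0, which does not occur in the series below.)
\<close>

typedef 'a mseries = "UNIV :: (nat multiset \<Rightarrow> 'a) set"
  morphisms mcoeff MSeries by simp

lemma mcoeff_MSeries [simp]: "mcoeff (MSeries f) = f"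
  by (simp add: MSeries_inverse)

lemma mseries_eqI: "(\<And>m. mcoeff f m = mcoeff g m) \<Longrightarrow> f = g"
  by (metis ext mcoeff_inject)

lemma finite_submultisets [simp]: "finite {a. a \<subseteq># (m :: 'a multiset)}"
proof (rule finite_subset)
  show "{a. a \<subseteq># m} \<subseteq> mset ` {xs. set xs \<subseteq> set_mset m \<and> length xs \<le> size m}"
  proof
    fix a assume a: "a \<in> {a. a \<subseteq># m}"
    obtain xs where xs: "mset xs = a" using ex_mset by blast
    have "set xs \<subseteq> set_mset m"
      using a xs set_mset_mono by fastforce
    moreover have "length xs \<le> size m"
      using a xs size_mset_mono by fastforce
    ultimately show "a \<in> mset ` {xs. set xs \<subseteq> set_mset m \<and> length xs \<le> size m}"
      using xs by blast
  qed
qed (simp add: finite_lists_length_le)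

lemma diff_diff_submultiset: "a \<subseteq># m \<Longrightarrow> m - (m - a) = a"
  by (simp add: multiset_eq_iff subseteq_mset_def)

lemma diff_diff_submultiset2: "b \<subseteq># a \<Longrightarrow> m - b - (a - b) = m - a"
  by (metis diff_diff_add_mset subset_mset.add_diff_inverse)

instantiation mseries :: (comm_semiring_1) comm_semiring_1
begin

definition "0 = MSeries (\<lambda>_. 0)"
definition "1 = MSeries (\<lambda>m. if m = {#} then 1 else 0)"
definition "f + g = MSeries (\<lambda>m. mcoeff f m + mcoeff g m)"
definition "f * g = MSeries (\<lambda>m. \<Sum>a | a \<subseteq># m. mcoeff f a * mcoeff g (m - a))"

instance
proof
  fix f g h :: "'a mseries"
  show "f + g + h = f + (g + h)"
    by (rule mseries_eqI) (simp add: plus_mseries_def ac_simps)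
  show "f + g = g + f"
    by (rule mseries_eqI) (simp add: plus_mseries_def ac_simps)
  show "0 + f = f"
    by (rule mseries_eqI) (simp add: plus_mseries_def zero_mseries_def)
  show "0 * f = 0"
    by (rule mseries_eqI) (simp add: times_mseries_def zero_mseries_def)
  show "f * 0 = 0"
    by (rule mseries_eqI) (simp add: times_mseries_def zero_mseries_def)
  show "(f + g) * h = f * h + g * h"
    by (rule mseries_eqI) (simp add: times_mseries_def plus_mseries_def algebra_simps sum.distrib)
  show "(0 :: 'a mseries) \<noteq> 1"
  proof
    assume "(0 :: 'a mseries) = 1"
    then have "mcoeff (0 :: 'a mseries) {#} = mcoeff 1 {#}" by simp
    then show False by (simp add: zero_mseries_def one_mseries_def)
  qed
  show "1 * f = f"
  proof (rule mseries_eqI)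
    fix m
    have "mcoeff (1 * f) m = (\<Sum>a | a \<subseteq># m. (if a = {#} then 1 else 0) * mcoeff f (m - a))"
      by (simp add: times_mseries_def one_mseries_def)
    also have "\<dots> = (\<Sum>a | a \<subseteq># m. if a = {#} then mcoeff f m else 0)"
      by (rule sum.cong) auto
    also have "\<dots> = mcoeff f m"
      by (simp add: sum.delta)
    finally show "mcoeff (1 * f) m = mcoeff f m" .
  qed
  show "f * g = g * f"
  proof (rule mseries_eqI)
    fix m
    show "mcoeff (f * g) m = mcoeff (g * f) m"
      unfolding times_mseries_def mcoeff_MSeries
      by (rule sum.reindex_bij_witness[where i = "\<lambda>a. m - a" and j = "\<lambda>a. m - a"])
        (auto simp: mult.commute diff_diff_submultiset)
  qed
  show "f * g * h = f * (g * h)"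
  proof (rule mseries_eqI)
    fix m
    have "mcoeff (f * g * h) m
        = (\<Sum>(c, a) \<in> (SIGMA c:{c. c \<subseteq># m}. {a. a \<subseteq># c}).
             mcoeff f a * mcoeff g (c - a) * mcoeff h (m - c))"
      unfolding times_mseries_def mcoeff_MSeries sum_distrib_right
      by (rule sum.Sigma) auto
    also have "\<dots> = (\<Sum>(a, b) \<in> (SIGMA a:{a. a \<subseteq># m}. {b. b \<subseteq># m - a}).
             mcoeff f a * (mcoeff g b * mcoeff h (m - a - b)))"
      by (rule sum.reindex_bij_witness[where i = "\<lambda>(a, b). (a + b, a)"
            and j = "\<lambda>(c, a). (a, c - a)"])
        (auto simp: mult.assoc diff_diff_submultiset2 subseteq_mset_def le_diff_conv2
          add.commute diff_le_mono intro: le_trans)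
    also have "\<dots> = mcoeff (f * (g * h)) m"
      unfolding times_mseries_def mcoeff_MSeries sum_distrib_left
      by (rule sum.Sigma [symmetric]) auto
    finally show "mcoeff (f * g * h) m = mcoeff (f * (g * h)) m" .
  qed
qed

end

definition mconst :: "'a::zero \<Rightarrow> 'a mseries" where
  "mconst c = MSeries (\<lambda>m. if m = {#} then c else 0)"

section \<open>Permutation representations and the Frobenius characteristic\<close>

text \<open>The symmetric group permutes \<open>{..<n}\<close>.\<close>

definition perms :: "nat \<Rightarrow> (nat \<Rightarrow> nat) set" where
  "perms n = {w. w permutes {..<n}}"

definition cycle_type :: "nat \<Rightarrow> (nat \<Rightarrow> nat) \<Rightarrow> nat multiset" where
  "cycle_type n w = image_mset card (mset_set (orbit w ` {..<n}))"

definition power_sum :: "nat \<Rightarrow> rat mseries" where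
  "power_sum k = MSeries (\<lambda>m. if \<exists>i\<ge>1. m = replicate_mset k i then 1 else 0)"

definition power_sums :: "nat multiset \<Rightarrow> rat mseries" where
  "power_sums \<mu> = (\<Prod>k\<in>#\<mu>. power_sum k)"

definition frobenius_char :: "nat \<Rightarrow> ((nat \<Rightarrow> nat) \<Rightarrow> rat) \<Rightarrow> rat mseries" where
  "frobenius_char n \<psi> =
     mconst (1 / fact n) * (\<Sum>w\<in>perms n. mconst (\<psi> w) * power_sums (cycle_type n w))"

text \<open>Column \<open>y\<close> of the matrix of \<open>w\<close> is the basis vector of \<open>act w y\<close>.\<close>

definition perm_rep :: "('g \<Rightarrow> 'x \<Rightarrow> 'x) \<Rightarrow> 'g \<Rightarrow> 'x \<Rightarrow> 'x \<Rightarrow> rat" where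
  "perm_rep act w = (\<lambda>x y. if x = act w y then 1 else 0)"

definition perm_character :: "'x set \<Rightarrow> ('g \<Rightarrow> 'x \<Rightarrow> 'x) \<Rightarrow> 'g \<Rightarrow> rat" where
  "perm_character X act w = (\<Sum>x\<in>X. perm_rep act w x x)"

definition frobenius_char_action ::
  "nat \<Rightarrow> 'x set \<Rightarrow> ((nat \<Rightarrow> nat) \<Rightarrow> 'x \<Rightarrow> 'x) \<Rightarrow> rat mseries" where
  "frobenius_char_action n X act = frobenius_char n (perm_character X act)"

section \<open>The Shi arrangement\<close>

text \<open>Coordinates are indexed by \<open>0, \<dots>, n - 1\<close>.\<close>

definition shi_arrangement :: "nat \<Rightarrow> (nat \<Rightarrow> real) set set" where
  "shi_arrangement n =
     {{x \<in> topspace (Euclidean_space n). x i - x j = c} | i j c. i < j \<and> j < n \<and> c \<in> {0, 1}}"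

definition shi_regions :: "nat \<Rightarrow> (nat \<Rightarrow> real) set set" where
  "shi_regions n =
     connected_components_of (subtopology (Euclidean_space n) (- \<Union>(shi_arrangement n)))"

section \<open>Parking functions\<close>

definition parking_functions :: "nat \<Rightarrow> nat list set" where
  "parking_functions n =
     {a. length a = n \<and> (\<forall>k\<in>set a. 1 \<le> k) \<and> (\<forall>i<n. sort a ! i \<le> Suc i)}"

text \<open>
  Since \<open>permute_list\<close> is a right action, the inverse gives the left action
  \<open>(w \<cdot> a)\<^sub>i = a\<^bsub>w\<^sup>-\<^sup>1(i)\<^esub>\<close>.
\<close>

definition parking_action :: "(nat \<Rightarrow> nat) \<Rightarrow> nat list \<Rightarrow> nat list" where
  "parking_action w a = permute_list (inv w) a"

definition transport_action ::
  "'x set \<Rightarrow> ('x \<Rightarrow> 'y) \<Rightarrow> ('g \<Rightarrow> 'y \<Rightarrow> 'y) \<Rightarrow> 'g \<Rightarrow> 'x \<Rightarrow> 'x" where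
  "transport_action X \<phi> act w x = inv_into X \<phi> (act w (\<phi> x))"

section \<open>Labeled trees\<close>

definition labeled_trees :: "nat \<Rightarrow> nat tree set" where
  "labeled_trees n = {T. size T = n \<and> (\<forall>a\<in>set_tree T. 1 \<le> a)}"

fun root_labels :: "'a tree \<Rightarrow> 'a multiset" where
  "root_labels Leaf = {#}"
| "root_labels (Node l a r) = {#a#}"

text \<open>Every edge is recorded as the pair (label of the parent, label of the child).\<close>

fun left_edges :: "'a tree \<Rightarrow> ('a \<times> 'a) multiset" where
  "left_edges Leaf = {#}"
| "left_edges (Node l a r) = {#(a, b). b \<in># root_labels l#} + left_edges l + left_edges r"

fun right_edges :: "'a tree \<Rightarrow> ('a \<times> 'a) multiset" where
  "right_edges Leaf = {#}"
| "right_edges (Node l a r) = {#(a, b). b \<in># root_labels r#} + right_edges l + right_edges r"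

definition lasc :: "nat tree \<Rightarrow> nat" where
  "lasc T = size {#(p, c) \<in># left_edges T. c \<le> p#}"

definition ldes :: "nat tree \<Rightarrow> nat" where
  "ldes T = size {#(p, c) \<in># left_edges T. c > p#}"

definition rasc :: "nat tree \<Rightarrow> nat" where
  "rasc T = size {#(p, c) \<in># right_edges T. p \<le> c#}"

definition rdes :: "nat tree \<Rightarrow> nat" where
  "rdes T = size {#(p, c) \<in># right_edges T. p > c#}"

text \<open>
  The parameters are \<open>\<lambda>\<close>-bar, \<open>\<lambda>\<close>, \<open>\<rho>\<close>-bar, \<open>\<rho>\<close>, in this order. Only finitely many trees have
  a given multiset of labels, so every coefficient is a finite sum. Note \<open>0 ^ 0 = 1\<close>.
\<close>

definition tree_series ::
  "nat \<Rightarrow> 'a \<Rightarrow> 'a \<Rightarrow> 'a \<Rightarrow> 'a \<Rightarrow> 'a::comm_semiring_1 mseries" where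
  "tree_series n la ld ra rd = MSeries (\<lambda>m. \<Sum>T | T \<in> labeled_trees n \<and> mset_tree T = m.
     la ^ lasc T * ld ^ ldes T * ra ^ rasc T * rd ^ rdes T)"

end

theory Submission
  imports Defs
begin

text \<open>
  By Burnside's lemma, the coefficient of a monomial \<open>m\<close> in the Frobenius characteristic is the number
  of multisets of pairs whose first components form a parking function and whose second components
  form \<open>m\<close>. Grouped by first component, such a multiset is a Lukasiewicz word of multisets. A tree
  without right descents is encoded by such a word as well: every maximal right chain is weakly
  increasing, hence determined by its multiset of labels, and the chains of all left subtrees are
  listed in preorder.

  The regions of the Shi arrangement are the nonempty sets of points with a given sign pattern. They
  are matched with parking functions by the bijection of Athanasiadis and Linusson: sorting the
  coordinates decreasingly, the maximal pairs \<open>i < j\<close> with \<open>0 < x\<^sub>i - x\<^sub>j < 1\<close> form nonnesting chains, and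
  \<open>a\<^sub>i\<close> is the position of the top of the chain of \<open>i\<close>.
\<close>

section \<open>Trees without right descents\<close>

text \<open>Both sides meet in one inequality. A multiset of \<open>n\<close> positive integers is
  parking when, for every \<open>j \<le> n\<close>, at least \<open>j\<close> of its entries are at
  most \<open>j\<close>. A word of \<open>n + 1\<close> multisets with \<open>n\<close> elements in
  total satisfies \<open>lukasiewicz 1\<close> when, for every \<open>j \<le> n\<close>, its first
  \<open>j\<close> letters contain at least \<open>j\<close> elements. Listing a biword column by
  column turns one condition into the other.

  On the side of the regions, \<open>represents\<close> relates functions to points, and through it
  a function and a sign pattern determine each other. The obstacle is to produce a point for a given
  function, because inside an open region many small gaps would have to be controlled. Spacing the
  elements of each chain by exactly 1 makes its arcs maximal for a trivial reason, but it puts the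
  point on hyperplanes x_i - x_j = 1. Patterns and close pairs are therefore set up for all points
  with distinct coordinates, such hyperplanes being counted to the side below 1, and points are
  moved off them only at the very end.\<close>

fun spine :: "'a tree \<Rightarrow> 'a list" where
  "spine Leaf = []"
| "spine (Node l a r) = a # spine r"

fun code :: "'a tree \<Rightarrow> 'a multiset list" where
  "code Leaf = []"
| "code (Node l a r) = mset (spine l) # code l @ code r"

text \<open>The spine of the tree itself is left free: in \<open>ex1_tree_code\<close> gluing gives
  it a list that need not be sorted.\<close>

fun left_sorted :: "'a::linorder tree \<Rightarrow> bool" where
  "left_sorted Leaf = True"
| "left_sorted (Node l a r) = (sorted (spine l) \<and> left_sorted l \<and> left_sorted r)"

text \<open>Grafts the second tree at the lower end of the right spine of the first. Codes then
  concatenate, so \<open>code l @ code r\<close> is again the code of a single tree and a word can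
  be decoded letter by letter.\<close>

fun glue :: "'a tree \<Rightarrow> 'a tree \<Rightarrow> 'a tree" where
  "glue Leaf t = t"
| "glue (Node l a r) t = Node l a (glue r t)"

text \<open>\<open>k\<close> counts the nodes whose left subtree is still to be read: a letter
  settles one node and opens the nodes of its own chain.\<close>

fun lukasiewicz :: "nat \<Rightarrow> 'a multiset list \<Rightarrow> bool" where
  "lukasiewicz k [] = (k = 0)"
| "lukasiewicz k (C # u) = (0 < k \<and> lukasiewicz (k - 1 + size C) u)"

lemma spine_glue [simp]: "spine (glue s t) = spine s @ spine t"
  by (induction s) auto

lemma code_glue [simp]: "code (glue s t) = code s @ code t"
  by (induction s) auto

lemma left_sorted_glue [simp]: "left_sorted (glue s t) \<longleftrightarrow> left_sorted s \<and> left_sorted t"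
  by (induction s) auto

lemma glue_inject:
  "length (spine s) = length (spine s') \<Longrightarrow> glue s t = glue s' t' \<Longrightarrow> s = s' \<and> t = t'"
proof (induction s arbitrary: s')
  case Leaf
  then show ?case by (cases s') auto
next
  case (Node l a r)
  then show ?case by (cases s') auto
qed

lemma glue_split: "k \<le> length (spine t) \<Longrightarrow> \<exists>l r. t = glue l r \<and> length (spine l) = k"
proof (induction k arbitrary: t)
  case 0
  show ?case by (rule exI[of _ Leaf]) simp
next
  case (Suc k)
  then obtain l a r where t: "t = Node l a r" by (cases t) auto
  with Suc obtain l' r' where "r = glue l' r'" "length (spine l') = k" by fastforce
  with t show ?case by (intro exI[of _ "Node l a l'"] exI[of _ r']) simp
qed

lemma length_code [simp]: "length (code t) = size t"
  by (induction t) auto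

text \<open>Each node lies on exactly one maximal right chain, which starts at the root or at a left
  child.\<close>

lemma mset_tree_code: "mset_tree t = mset (spine t) + sum_list (code t)"
  by (induction t) auto

lemma lukasiewicz_append: "lukasiewicz i u \<Longrightarrow> lukasiewicz j v \<Longrightarrow> lukasiewicz (i + j) (u @ v)"
proof (induction u arbitrary: i)
  case (Cons C u)
  have "lukasiewicz (i - 1 + size C + j) (u @ v)"
    by (rule Cons.IH) (use Cons.prems in auto)
  moreover have "i - 1 + size C + j = i + j - 1 + size C" using Cons.prems by auto
  ultimately have "lukasiewicz (i + j - 1 + size C) (u @ v)" by (simp only:)
  with Cons.prems show ?case by simp
qed simp

lemma lukasiewicz_code: "lukasiewicz (length (spine t)) (code t)"
  by (induction t) (auto simp: lukasiewicz_append add.commute)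

text \<open>After \<open>j\<close> letters \<open>j\<close> open nodes have been settled and the
  sizes of these letters gained, and the balance may vanish only at the end. In this form the
  condition is compared with the parking condition.\<close>

lemma lukasiewicz_iff:
  "lukasiewicz k u \<longleftrightarrow> length u = k + size (sum_list u) \<and>
     (\<forall>j<length u. j < k + size (sum_list (take j u)))"
proof (induction u arbitrary: k)
  case (Cons C u)
  show ?case unfolding lukasiewicz.simps Cons.IH
    by (auto simp: less_Suc_eq_0_disj all_conj_distrib)
qed auto

text \<open>
  Read off the first multiset \<open>C\<close>: the left subtree of the root has spine \<open>C\<close>, and gluing the
  right subtree below it gives a tree with spine \<open>C\<close> followed by the rest of \<open>s\<close> and a shorter code.
\<close>

lemma ex1_tree_code:
  "lukasiewicz (length s) u \<Longrightarrow> \<exists>!t. left_sorted t \<and> spine t = s \<and> code t = u"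
proof (induction u arbitrary: s)
  case Nil
  have "t = Leaf" if "code t = []" for t :: "'a tree"
    using that by (cases t) auto
  with Nil show ?case by (auto intro!: ex1I[of _ Leaf])
next
  case (Cons C u)
  then obtain a s' where s: "s = a # s'" by (cases s) auto
  let ?c = "sorted_list_of_multiset C"
  have len: "length ?c = size C"
    by (metis mset_sorted_list_of_multiset size_mset)
  have "lukasiewicz (length (?c @ s')) u"
    using Cons.prems s len by (simp add: add.commute)
  from Cons.IH[OF this] obtain x where x: "left_sorted x" "spine x = ?c @ s'" "code x = u"
    and uniq: "\<And>y. left_sorted y \<Longrightarrow> spine y = ?c @ s' \<Longrightarrow> code y = u \<Longrightarrow> y = x"
    by blast
  obtain l r where lr: "x = glue l r" "length (spine l) = length ?c"
    using glue_split[of "length ?c" x] x by auto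
  with x have sp: "spine l = ?c" "spine r = s'" by auto
  show ?case
  proof (rule ex1I[of _ "Node l a r"])
    show "left_sorted (Node l a r) \<and> spine (Node l a r) = s \<and> code (Node l a r) = C # u"
      using x lr sp s by auto
  next
    fix t assume t: "left_sorted t \<and> spine t = s \<and> code t = C # u"
    then obtain l' r' where t': "t = Node l' a r'" using s by (cases t) auto
    have c': "spine l' = ?c"
      using t t' by (auto simp: sorted_list_of_multiset_mset sorted_sort_id)
    have "glue l' r' = x"
      by (rule uniq) (use t t' s c' in auto)
    with lr c' t' show "t = Node l a r" using glue_inject[of l' l r' r] by simp
  qed
qed

lemma rdes_Node:
  "rdes (Node l a r) = 0 \<longleftrightarrow> rdes l = 0 \<and> rdes r = 0 \<and> (\<forall>b\<in>#root_labels r. a \<le> b)"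
  unfolding rdes_def by (cases r) auto

lemma spine_root_labels: "sorted (spine r) \<Longrightarrow> (\<forall>b\<in>#root_labels r. a \<le> b) \<longleftrightarrow> (\<forall>b\<in>set (spine r). a \<le> b)"
  by (cases r) auto

text \<open>Right edges join neighbours on a maximal right chain, so every such chain must be
  sorted: those of the left subtrees, and the spine.\<close>

lemma rdes_eq_0_iff: "rdes t = 0 \<longleftrightarrow> left_sorted t \<and> sorted (spine t)"
proof (induction t)
  case Leaf
  show ?case by (simp add: rdes_def)
next
  case (Node l a r)
  then show ?case using spine_root_labels[of r a] by (auto simp: rdes_Node)
qed

text \<open>Putting the spine of \<open>t\<close> in front amounts to making \<open>t\<close> the
  left subtree of an extra node; hence \<open>n + 1\<close> letters and the initial value 1.
  Sortedness recovers the spine from its multiset.\<close>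

lemma bij_betw_tree_code:
  "bij_betw (\<lambda>t. mset (spine t) # code t)
     {t. rdes t = 0 \<and> size t = n \<and> mset_tree t = m}
     {u. length u = Suc n \<and> sum_list u = m \<and> lukasiewicz 1 u}"
proof (rule bij_betwI')
  fix t t' :: "nat tree"
  assume *: "t \<in> {t. rdes t = 0 \<and> size t = n \<and> mset_tree t = m}"
    "t' \<in> {t. rdes t = 0 \<and> size t = n \<and> mset_tree t = m}"
  show "(mset (spine t) # code t = mset (spine t') # code t') \<longleftrightarrow> t = t'"
  proof
    assume eq: "mset (spine t) # code t = mset (spine t') # code t'"
    with * have "spine t = spine t'"
      by (metis (mono_tags, lifting) list.inject mem_Collect_eq rdes_eq_0_iff
          sorted_list_of_multiset_mset sorted_sort_id)
    with * eq ex1_tree_code[OF lukasiewicz_code[of t]] show "t = t'"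
      by (auto simp: rdes_eq_0_iff)
  qed simp
next
  fix t :: "nat tree"
  assume "t \<in> {t. rdes t = 0 \<and> size t = n \<and> mset_tree t = m}"
  then show "mset (spine t) # code t \<in> {u. length u = Suc n \<and> sum_list u = m \<and> lukasiewicz 1 u}"
    using lukasiewicz_code[of t] mset_tree_code[of t] by auto
next
  fix u :: "nat multiset list"
  assume u: "u \<in> {u. length u = Suc n \<and> sum_list u = m \<and> lukasiewicz 1 u}"
  then obtain C v where Cv: "u = C # v" by (cases u) auto
  let ?c = "sorted_list_of_multiset C"
  have "length ?c = size C"
    by (metis mset_sorted_list_of_multiset size_mset)
  then have "lukasiewicz (length ?c) v" using u Cv by simp
  from ex1_tree_code[OF this] obtain t where "left_sorted t" "spine t = ?c" "code t = v" by blast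
  then show "\<exists>t\<in>{t. rdes t = 0 \<and> size t = n \<and> mset_tree t = m}. u = mset (spine t) # code t"
    using u Cv by (intro bexI[of _ t]) (auto simp: rdes_eq_0_iff mset_tree_code simp flip: length_code)
qed

section \<open>Power sums and Burnside's lemma\<close>

lemma mcoeff_mconst_times: "mcoeff (mconst c * f) m = c * mcoeff f m"
proof -
  have "mcoeff (mconst c * f) m = (\<Sum>a | a \<subseteq># m. if a = {#} then c * mcoeff f m else 0)"
    unfolding times_mseries_def mconst_def mcoeff_MSeries by (rule sum.cong) auto
  then show ?thesis by (simp add: sum.delta)
qed

lemma mcoeff_sum: "mcoeff (sum f A) m = (\<Sum>a\<in>A. mcoeff (f a) m)"
  by (induction A rule: infinite_finite_induct) (auto simp: zero_mseries_def plus_mseries_def)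

lemma finite_PiE_multiset_sum:
  fixes k :: "'b \<Rightarrow> nat"
  assumes "finite P" "\<And>p. p \<in> P \<Longrightarrow> 0 < k p"
  shows "finite {f \<in> P \<rightarrow>\<^sub>E {1..}. (\<Sum>p\<in>P. replicate_mset (k p) (f p)) = (m :: nat multiset)}"
proof (rule finite_subset)
  show "{f \<in> P \<rightarrow>\<^sub>E {1..}. (\<Sum>p\<in>P. replicate_mset (k p) (f p)) = m} \<subseteq> P \<rightarrow>\<^sub>E set_mset m"
  proof
    fix f assume f: "f \<in> {f \<in> P \<rightarrow>\<^sub>E {1..}. (\<Sum>p\<in>P. replicate_mset (k p) (f p)) = m}"
    have "f p \<in># m" if "p \<in> P" for p
    proof -
      have "f p \<in># replicate_mset (k p) (f p)" using assms(2)[OF that] by simp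
      then have "f p \<in># (\<Sum>p\<in>P. replicate_mset (k p) (f p))"
        unfolding set_mset_sum[OF assms(1)] using that by blast
      then show ?thesis using f by simp
    qed
    then show "f \<in> P \<rightarrow>\<^sub>E set_mset m" using f by (auto simp: PiE_iff)
  qed
qed (use assms in \<open>auto intro: finite_PiE\<close>)

text \<open>Expanding the product, \<open>f\<close> records the variable taken from each factor.
  Positive exponents are what make the variable recoverable from its power.\<close>

lemma mcoeff_prod_power_sum:
  assumes "finite P" "\<And>p. p \<in> P \<Longrightarrow> 0 < k p"
  shows "mcoeff (\<Prod>p\<in>P. power_sum (k p)) m =
    of_nat (card {f \<in> P \<rightarrow>\<^sub>E {1..}. (\<Sum>p\<in>P. replicate_mset (k p) (f p)) = m})"
  using assms
proof (induction P arbitrary: m)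
  case empty
  have "{f \<in> {} \<rightarrow>\<^sub>E {1..}. (\<Sum>p\<in>{}. replicate_mset (k p) (f p)) = m} =
    (if m = {#} then {\<lambda>_. undefined} else {})" by auto
  then show ?case by (simp add: one_mseries_def)
next
  case (insert q P)
  let ?S = "\<lambda>P m. {f \<in> P \<rightarrow>\<^sub>E {1..}. (\<Sum>p\<in>P. replicate_mset (k p) (f p)) = m}"
  let ?A = "{i \<in> set_mset m. 1 \<le> i \<and> replicate_mset (k q) i \<subseteq># m}"
  have kq: "0 < k q" using insert.prems by simp
  have finS: "finite (?S P a)" for a :: "nat multiset"
    by (rule finite_PiE_multiset_sum) (use insert in auto)
  have inj: "inj_on (replicate_mset (k q)) ?A"
    using kq by (auto simp: inj_on_def replicate_mset_eq_iff)
  have "mcoeff (\<Prod>p\<in>insert q P. power_sum (k p)) m =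
    (\<Sum>a | a \<subseteq># m. mcoeff (power_sum (k q)) a * of_nat (card (?S P (m - a))))"
    using insert by (simp add: times_mseries_def)
  also have "\<dots> = (\<Sum>a\<in>replicate_mset (k q) ` ?A. of_nat (card (?S P (m - a))))"
  proof (rule sum.mono_neutral_cong_right)
    show "replicate_mset (k q) ` ?A \<subseteq> {a. a \<subseteq># m}" by auto
    have "a \<in> replicate_mset (k q) ` ?A" if "a \<subseteq># m" "1 \<le> i" "a = replicate_mset (k q) i" for a i
    proof -
      have "i \<in># a" using that kq by simp
      with that have "i \<in> ?A" by (auto dest: mset_subset_eqD)
      with that show ?thesis by blast
    qed
    then have "mcoeff (power_sum (k q)) a = 0"
      if "a \<in> {a. a \<subseteq># m} - replicate_mset (k q) ` ?A" for a
      unfolding power_sum_def mcoeff_MSeries using that by (intro if_not_P) blast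
    then show "\<forall>a\<in>{a. a \<subseteq># m} - replicate_mset (k q) ` ?A.
        mcoeff (power_sum (k q)) a * of_nat (card (?S P (m - a))) = 0"
      by simp
  next
    fix a assume "a \<in> replicate_mset (k q) ` ?A"
    then have "\<exists>i\<ge>1. a = replicate_mset (k q) i" by blast
    then show "mcoeff (power_sum (k q)) a * of_nat (card (?S P (m - a))) = of_nat (card (?S P (m - a)))"
      by (simp add: power_sum_def)
  qed simp
  also have "\<dots> = (\<Sum>i\<in>?A. of_nat (card (?S P (m - replicate_mset (k q) i))))"
    by (subst sum.reindex[OF inj]) simp
  also have "\<dots> = of_nat (card (SIGMA i:?A. ?S P (m - replicate_mset (k q) i)))"
    using finS by (subst card_SigmaI) auto
  also have "card (SIGMA i:?A. ?S P (m - replicate_mset (k q) i)) = card (?S (insert q P) m)"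
  proof (rule bij_betw_same_card[of "\<lambda>(i, f). f(q := i)"], rule bij_betw_byWitness[where f' = "\<lambda>f. (f q, restrict f P)"])
    have sum_upd: "(\<Sum>p\<in>P. replicate_mset (k p) ((f(q := i)) p)) = (\<Sum>p\<in>P. replicate_mset (k p) (f p))"
      for f and i :: nat
      using insert.hyps by (intro sum.cong) auto
    show "(\<lambda>(i, f). f(q := i)) ` (SIGMA i:?A. ?S P (m - replicate_mset (k q) i)) \<subseteq> ?S (insert q P) m"
      using insert.hyps sum_upd
      by (auto simp: PiE_iff extensional_def simp del: fun_upd_apply)
        (auto split: if_splits)
    show "(\<lambda>f. (f q, restrict f P)) ` ?S (insert q P) m \<subseteq> (SIGMA i:?A. ?S P (m - replicate_mset (k q) i))"
      using insert.hyps kq by (auto simp: PiE_iff)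
    show "\<forall>z\<in>SIGMA i:?A. ?S P (m - replicate_mset (k q) i).
        (\<lambda>f. (f q, restrict f P)) ((\<lambda>(i, f). f(q := i)) z) = z"
      using insert.hyps by (auto simp: PiE_iff extensional_def restrict_def fun_eq_iff)
    show "\<forall>f\<in>?S (insert q P) m. (\<lambda>(i, f). f(q := i)) ((\<lambda>f. (f q, restrict f P)) f) = f"
      using insert.hyps by (auto simp: PiE_iff extensional_def restrict_def fun_eq_iff)
  qed
  finally show ?case .
qed

lemma sum_singleton_mset: "finite A \<Longrightarrow> (\<Sum>i\<in>A. {#x#}) = replicate_mset (card A) x"
  by (induction A rule: finite_induct) auto

lemma permutes_orbit_props:
  assumes "w permutes {..<n :: nat}"
  shows "i \<in> orbit w i" "i < n \<Longrightarrow> orbit w i \<subseteq> {..<n}"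
    "j \<in> orbit w i \<Longrightarrow> orbit w j = orbit w i" "orbit w (w i) = orbit w i"
proof -
  have perm: "permutation w" unfolding permutation_permutes by (intro exI[of _ "{..<n}"]) (simp add: assms)
  show *: "i \<in> orbit w i" for i using permutation_self_in_orbit[OF perm] .
  show "i < n \<Longrightarrow> orbit w i \<subseteq> {..<n}"
    using assms by (simp add: permutes_orbit_subset)
  show eq: "j \<in> orbit w i \<Longrightarrow> orbit w j = orbit w i" for i j
    using cyclic_on_orbit'[OF perm] by (rule orbit_cyclic_eq3)
  show "orbit w (w i) = orbit w i" by (rule eq) (rule orbit.base)
qed

lemma permute_list_eq_iff:
  assumes "w permutes {..<length xs}"
  shows "permute_list w xs = xs \<longleftrightarrow> (\<forall>i<length xs. xs ! w i = xs ! i)"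
  using assms by (auto simp: list_eq_iff_nth_eq permute_list_nth)

text \<open>A word fixed by \<open>w\<close> is constant on the cycles of \<open>w\<close>, so it
  amounts to one variable per cycle; a cycle of length k contributes the k-th power of its
  variable.\<close>

lemma mcoeff_power_sums_cycle_type:
  assumes w: "w permutes {..<n}"
  shows "mcoeff (power_sums (cycle_type n w)) m =
    of_nat (card {c. length c = n \<and> (\<forall>k\<in>set c. 1 \<le> k) \<and> mset c = m \<and> permute_list w c = c})"
proof -
  let ?P = "orbit w ` {..<n}"
  note orb = permutes_orbit_props[OF w]
  have sub: "p \<subseteq> {..<n}" if "p \<in> ?P" for p using that orb(2) by auto
  have fin: "finite p" if "p \<in> ?P" for p using sub[OF that] finite_subset by blast
  have pos: "0 < card p" if "p \<in> ?P" for p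
    using fin[OF that] that orb(1) by (auto simp: card_gt_0_iff)
  have nth_orbit: "c ! j = c ! i" if "j \<in> orbit w i" "permute_list w c = c" "length c = n" "i < n" for c :: "nat list" and i j
    using that(1)
  proof induction
    case base
    then show ?case using that w permute_list_eq_iff[of w c] by simp
  next
    case (step j)
    then show ?case using that w permute_list_eq_iff[of w c] orb(2)[of i] by auto
  qed
  have disj: "p \<inter> q = {}" if "p \<in> ?P" "q \<in> ?P" "p \<noteq> q" for p q
    using that orb(3) by blast
  have Union: "\<Union>?P = {..<n}" using orb(1,2) by blast
  have mset_sum: "(\<Sum>p\<in>?P. replicate_mset (card p) (f p)) = mset (map (\<lambda>i. f (orbit w i)) [0..<n])"
    for f :: "nat set \<Rightarrow> nat"
  proof -
    have "(\<Sum>p\<in>?P. replicate_mset (card p) (f p)) = (\<Sum>p\<in>?P. \<Sum>i\<in>p. {#f (orbit w i)#})"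
    proof (rule sum.cong)
      fix p assume p: "p \<in> ?P"
      then have "(\<Sum>i\<in>p. {#f (orbit w i)#}) = (\<Sum>i\<in>p. {#f p#})"
        using orb(3) by (intro sum.cong) auto
      then show "replicate_mset (card p) (f p) = (\<Sum>i\<in>p. {#f (orbit w i)#})"
        using fin[OF p] by (simp only: sum_singleton_mset)
    qed simp
    also have "\<dots> = (\<Sum>i\<in>\<Union>?P. {#f (orbit w i)#})"
      using fin disj by (subst sum.Union_disjoint) (auto)
    also have "\<dots> = image_mset (\<lambda>i. f (orbit w i)) (mset_set {..<n})"
      unfolding Union by (induction n) (auto simp: lessThan_Suc)
    finally show ?thesis by (simp add: lessThan_atLeast0 flip: mset_set_upto_eq_mset_upto)
  qed
  have "mcoeff (power_sums (cycle_type n w)) m = mcoeff (\<Prod>p\<in>?P. power_sum (card p)) m"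
    by (simp add: power_sums_def cycle_type_def multiset.map_comp comp_def prod_unfold_prod_mset)
  also have "\<dots> = of_nat (card {f \<in> ?P \<rightarrow>\<^sub>E {1..}. (\<Sum>p\<in>?P. replicate_mset (card p) (f p)) = m})"
    using pos by (intro mcoeff_prod_power_sum) auto
  also have "card {f \<in> ?P \<rightarrow>\<^sub>E {1..}. (\<Sum>p\<in>?P. replicate_mset (card p) (f p)) = m} =
     card {c. length c = n \<and> (\<forall>k\<in>set c. 1 \<le> k) \<and> mset c = m \<and> permute_list w c = c}"
  proof (rule bij_betw_same_card, rule bij_betw_byWitness)
    let ?F = "\<lambda>f. map (\<lambda>i. f (orbit w i)) [0..<n]"
    \<comment> \<open>Any representative of the cycle will do, by \<open>nth_orbit\<close>.\<close>
    let ?G = "\<lambda>c. \<lambda>p\<in>?P. c ! (SOME i. i \<in> p)"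
    have G: "?G c (orbit w i) = c ! i" if "permute_list w c = c" "length c = n" "i < n" for c :: "nat list" and i
    proof -
      have "(SOME j. j \<in> orbit w i) \<in> orbit w i" using orb(1) by (rule someI)
      with nth_orbit[OF _ that] that(3) show ?thesis by simp
    qed
    show "\<forall>f\<in>{f \<in> ?P \<rightarrow>\<^sub>E {1..}. (\<Sum>p\<in>?P. replicate_mset (card p) (f p)) = m}. ?G (?F f) = f"
    proof safe
      fix f :: "nat set \<Rightarrow> nat" assume f: "f \<in> ?P \<rightarrow>\<^sub>E {1..}"
      show "?G (?F f) = f"
      proof
        fix p
        show "?G (?F f) p = f p"
        proof (cases "p \<in> ?P")
          case True
          then obtain i where i: "i < n" "p = orbit w i" by auto
          then have "(SOME j. j \<in> p) \<in> orbit w i" using orb(1)[of i] by (auto intro: someI)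
          moreover from this have "(SOME j. j \<in> p) < n" using orb(2)[OF i(1)] by auto
          ultimately show ?thesis using orb(3) True i(2) by auto
        next
          case False
          then show ?thesis using f by (auto simp: PiE_iff extensional_def)
        qed
      qed
    qed
    show "\<forall>c\<in>{c. length c = n \<and> (\<forall>k\<in>set c. 1 \<le> k) \<and> mset c = m \<and> permute_list w c = c}. ?F (?G c) = c"
      using G by (auto simp: list_eq_iff_nth_eq simp del: restrict_apply)
    show "?F ` {f \<in> ?P \<rightarrow>\<^sub>E {1..}. (\<Sum>p\<in>?P. replicate_mset (card p) (f p)) = m} \<subseteq>
      {c. length c = n \<and> (\<forall>k\<in>set c. 1 \<le> k) \<and> mset c = m \<and> permute_list w c = c}"
    proof safe
      fix f assume f: "f \<in> ?P \<rightarrow>\<^sub>E {1..}" and m: "m = (\<Sum>p\<in>?P. replicate_mset (card p) (f p))"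
      show "length (?F f) = n" by simp
      show "1 \<le> k" if "k \<in> set (?F f)" for k using that f by (auto simp: PiE_iff)
      show "mset (?F f) = (\<Sum>p\<in>?P. replicate_mset (card p) (f p))" by (rule mset_sum[symmetric])
      show "permute_list w (?F f) = ?F f"
        using w orb(4) permutes_in_image[OF w] by (auto simp: permute_list_eq_iff)
    qed
    show "?G ` {c. length c = n \<and> (\<forall>k\<in>set c. 1 \<le> k) \<and> mset c = m \<and> permute_list w c = c}
      \<subseteq> {f \<in> ?P \<rightarrow>\<^sub>E {1..}. (\<Sum>p\<in>?P. replicate_mset (card p) (f p)) = m}"
    proof
      fix f assume "f \<in> ?G ` {c. length c = n \<and> (\<forall>k\<in>set c. 1 \<le> k) \<and> mset c = m \<and> permute_list w c = c}"
      then obtain c where c: "f = ?G c" "length c = n" "\<forall>k\<in>set c. 1 \<le> k" "mset c = m" "permute_list w c = c"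
        by blast
      have fi: "f (orbit w i) = c ! i" if "i < n" for i
        using G[OF c(5,2) that] c(1) by simp
      have "f \<in> ?P \<rightarrow>\<^sub>E {1..}"
        using fi c(1,2,3) by (auto simp: PiE_iff simp del: restrict_apply) 
      moreover have "map (\<lambda>i. f (orbit w i)) [0..<n] = c"
        using fi c(2) by (simp add: list_eq_iff_nth_eq)
      ultimately show "f \<in> {f \<in> ?P \<rightarrow>\<^sub>E {1..}. (\<Sum>p\<in>?P. replicate_mset (card p) (f p)) = m}"
        using c(4) by (simp only: mem_Collect_eq mset_sum simp_thms)
    qed
  qed
  finally show ?thesis .
qed

text \<open>The permutations carrying \<open>z\<close> to a given rearrangement form a coset of the stabiliser of \<open>z\<close>.\<close>

lemma card_stabilizer_times_card_rearrangements:
  assumes "length z = n"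
  shows "card {w \<in> perms n. permute_list w z = z} * card {y. mset y = mset z} = fact n"
proof -
  have fin: "finite (perms n)" by (simp add: perms_def finite_permutations)
  have card_eq: "card {w \<in> perms n. permute_list w z = y} = card {w \<in> perms n. permute_list w z = z}"
    if y: "mset y = mset z" for y
  proof -
    obtain v where v: "v permutes {..<n}" "permute_list v z = y"
      using mset_eq_permutation[OF y] assms by auto
    have "bij_betw (\<lambda>w. w \<circ> v) {w \<in> perms n. permute_list w z = z} {w \<in> perms n. permute_list w z = y}"
    proof (rule bij_betw_byWitness[where f' = "\<lambda>w. w \<circ> inv v"])
      have iv: "inv v permutes {..<n}" using v(1) by (rule permutes_inv)
      have "permute_list (inv v) y = permute_list (v \<circ> inv v) z"
        using permute_list_compose[of "inv v" z v] iv assms v(2) by simp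
      also have "\<dots> = z" using permutes_inv_o(1)[OF v(1)] by simp
      finally have zy: "permute_list (inv v) y = z" .
      show "\<forall>a\<in>{w \<in> perms n. permute_list w z = z}. a \<circ> v \<circ> inv v = a"
        using permutes_inv_o(1)[OF v(1)] by (simp add: o_assoc[symmetric])
      show "\<forall>a\<in>{w \<in> perms n. permute_list w z = y}. a \<circ> inv v \<circ> v = a"
        using permutes_inv_o(2)[OF v(1)] by (simp add: o_assoc[symmetric])
      show "(\<lambda>w. w \<circ> v) ` {w \<in> perms n. permute_list w z = z} \<subseteq> {w \<in> perms n. permute_list w z = y}"
        using v assms by (auto simp: perms_def permute_list_compose intro: permutes_compose)
      show "(\<lambda>w. w \<circ> inv v) ` {w \<in> perms n. permute_list w z = y} \<subseteq> {w \<in> perms n. permute_list w z = z}"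
        using iv zy assms by (auto simp: perms_def permute_list_compose intro: permutes_compose)
    qed
    then show ?thesis by (simp add: bij_betw_same_card)
  qed
  have finy: "finite {y. mset y = mset z}" by (rule mset_eq_finite)
  have "fact n = card (perms n)" by (simp add: perms_def card_permutations)
  also have "\<dots> = (\<Sum>y\<in>{y. mset y = mset z}. card {w \<in> perms n. permute_list w z = y})"
  proof (subst card_UN_disjoint[symmetric])
    show "card (perms n) = card (\<Union>y\<in>{y. mset y = mset z}. {w \<in> perms n. permute_list w z = y})"
      using assms by (intro arg_cong[of _ _ card]) (auto simp: perms_def)
  qed (use finy fin in auto)
  also have "\<dots> = (\<Sum>y\<in>{y. mset y = mset z}. card {w \<in> perms n. permute_list w z = z})"
    by (intro sum.cong refl card_eq) simp
  finally show ?thesis by simp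
qed

text \<open>The orbits of words under permutation of positions are their multisets. Counting the
  pairs of a word and a permutation fixing it in the other order, each multiset contributes
  \<open>fact n\<close>, by the orbit-stabiliser relation.\<close>

lemma burnside_lists:
  assumes "finite {z. length z = n \<and> mset z \<in> Q}"
  shows "(\<Sum>w\<in>perms n. card {z. length z = n \<and> mset z \<in> Q \<and> permute_list w z = z}) =
    fact n * card {M \<in> Q. size M = n}"
proof -
  let ?S = "{z. length z = n \<and> mset z \<in> Q}"
  have fin: "finite (perms n)" by (simp add: perms_def finite_permutations)
  have im: "mset ` ?S = {M \<in> Q. size M = n}"
  proof
    show "{M \<in> Q. size M = n} \<subseteq> mset ` ?S"
    proof
      fix M assume M: "M \<in> {M \<in> Q. size M = n}"
      obtain z where z: "mset z = M" using ex_mset by blast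
      with M have "length z = n" by (metis (mono_tags, lifting) mem_Collect_eq size_mset)
      with M z have "z \<in> ?S" by simp
      with z show "M \<in> mset ` ?S" by blast
    qed
  qed auto
  have "(\<Sum>w\<in>perms n. card {z. length z = n \<and> mset z \<in> Q \<and> permute_list w z = z}) =
     (\<Sum>w\<in>perms n. \<Sum>z\<in>?S. if permute_list w z = z then 1 else 0)"
    using assms by (intro sum.cong) (auto simp: sum.If_cases intro!: arg_cong[of _ _ card])
  also have "\<dots> = (\<Sum>z\<in>?S. card {w \<in> perms n. permute_list w z = z})"
    using fin by (subst sum.swap) (auto simp: sum.If_cases intro!: arg_cong[of _ _ card] sum.cong)
  also have "\<dots> = (\<Sum>M\<in>mset ` ?S. \<Sum>z\<in>{z\<in>?S. mset z = M}. card {w \<in> perms n. permute_list w z = z})"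
    using assms by (intro sum.group[symmetric]) auto
  also have "\<dots> = (\<Sum>M\<in>mset ` ?S. fact n)"
  proof (rule sum.cong)
    fix M assume M: "M \<in> mset ` ?S"
    then obtain z0 where z0: "length z0 = n" "mset z0 = M" "M \<in> Q" by auto
    have len: "length z = n" if "mset z = M" for z using that z0 by (metis size_mset)
    have set: "{z\<in>?S. mset z = M} = {z. mset z = M}" using len z0 by auto
    define N where "N = card {z. mset z = M}"
    have "finite {z. mset z = M}" using mset_eq_finite[of z0] z0(2) by simp
    then have "N \<noteq> 0" using z0(2) by (auto simp: N_def card_eq_0_iff)
    have stab: "card {w \<in> perms n. permute_list w z = z} * N = fact n" if "mset z = M" for z
      using card_stabilizer_times_card_rearrangements[OF len[OF that]] that by (simp add: N_def)
    have "card {w \<in> perms n. permute_list w z = z} = fact n div N" if "mset z = M" for z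
      unfolding stab[OF that, symmetric] using \<open>N \<noteq> 0\<close> by simp
    then have "(\<Sum>z\<in>{z\<in>?S. mset z = M}. card {w \<in> perms n. permute_list w z = z}) = N * (fact n div N)"
      unfolding set by (simp add: N_def)
    also have "\<dots> = fact n"
      using stab[OF z0(2)] by (metis dvd_triv_right dvd_mult_div_cancel)
    finally show "(\<Sum>z\<in>{z\<in>?S. mset z = M}. card {w \<in> perms n. permute_list w z = z}) = fact n" .
  qed simp
  finally show ?thesis by (simp add: im)
qed

section \<open>The Frobenius characteristic of parking functions\<close>

text \<open>The counting form of b_i \<le> i. It sees only the multiset of values, which makes
  invariance under permutations immediate.\<close>

definition parking_mset :: "nat \<Rightarrow> nat multiset \<Rightarrow> bool" where
  "parking_mset n A \<longleftrightarrow> size A = n \<and> 0 \<notin># A \<and> (\<forall>k\<le>n. k \<le> size {#x \<in># A. x \<le> k#})"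

text \<open>In a sorted list the entries at most \<open>v\<close> form a prefix.\<close>

lemma sorted_nth_le_iff:
  assumes "sorted xs" "i < length xs"
  shows "xs ! i \<le> v \<longleftrightarrow> i < length (filter (\<lambda>x. x \<le> v) xs)"
proof -
  have split: "length (filter (\<lambda>x. x \<le> v) xs) =
      length (filter (\<lambda>x. x \<le> v) (take j xs)) + length (filter (\<lambda>x. x \<le> v) (drop j xs))" for j
    by (metis append_take_drop_id filter_append length_append)
  show ?thesis
  proof
    assume "xs ! i \<le> v"
    then have "\<forall>x\<in>set (take (Suc i) xs). x \<le> v"
      using assms by (auto simp: in_set_conv_nth less_Suc_eq_le intro!: order_trans[OF sorted_nth_mono[of xs _ i]])
    then have "filter (\<lambda>x. x \<le> v) (take (Suc i) xs) = take (Suc i) xs" by (simp add: filter_id_conv)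
    then show "i < length (filter (\<lambda>x. x \<le> v) xs)" using split[of "Suc i"] assms(2) by simp
  next
    assume i: "i < length (filter (\<lambda>x. x \<le> v) xs)"
    show "xs ! i \<le> v"
    proof (rule ccontr)
      assume "\<not> xs ! i \<le> v"
      moreover have "xs ! i \<le> x" if "x \<in> set (drop i xs)" for x
        using that assms by (auto simp: in_set_conv_nth intro!: sorted_nth_mono)
      ultimately have "filter (\<lambda>x. x \<le> v) (drop i xs) = []"
        by (fastforce simp: filter_empty_conv)
      moreover have "length (filter (\<lambda>x. x \<le> v) (take i xs)) \<le> i"
        using length_filter_le[of "\<lambda>x. x \<le> v" "take i xs"] by simp
      ultimately show False using i split[of i] by simp
    qed
  qed
qed

lemma parking_functions_iff: "a \<in> parking_functions n \<longleftrightarrow> parking_mset n (mset a)"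
proof -
  have "size {#x \<in># mset a. x \<le> k#} = length (filter (\<lambda>x. x \<le> k) (sort a))" for k
    by (metis mset_filter mset_sort size_mset)
  then have "sort a ! i \<le> Suc i \<longleftrightarrow> Suc i \<le> size {#x \<in># mset a. x \<le> Suc i#}" if "i < length a" for i
    using that sorted_nth_le_iff[of "sort a" i "Suc i"] by auto
  moreover have "(\<forall>k\<le>n. P k) \<longleftrightarrow> P 0 \<and> (\<forall>i<n. P (Suc i))" for P
    by (metis Suc_le_eq nat.exhaust zero_le)
  moreover have "(\<forall>k\<in>set a. 1 \<le> k) \<longleftrightarrow> 0 \<notin> set a"
    by (metis less_one not_le)
  ultimately show ?thesis
    unfolding parking_functions_def parking_mset_def by auto
qed

lemma parking_mset_le: "parking_mset n A \<Longrightarrow> x \<in># A \<Longrightarrow> x \<le> n"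
proof (rule ccontr)
  assume A: "parking_mset n A" "x \<in># A" "\<not> x \<le> n"
  then have "{#x \<in># A. x \<le> n#} \<subset># A"
    by (metis filter_mset_eq_conv multiset_filter_subset subset_mset.less_le)
  then have "size {#x \<in># A. x \<le> n#} < n" using A(1) mset_subset_size by (auto simp: parking_mset_def)
  with A(1) show False by (auto simp: parking_mset_def)
qed

text \<open>
  The orbits of the symmetric group on pairs of a parking function \<open>a\<close> and a word \<open>c\<close> of content \<open>m\<close>,
  represented by the multiset of the pairs \<open>(a\<^sub>i, c\<^sub>i)\<close>.
\<close>

definition parking_biwords :: "nat \<Rightarrow> nat multiset \<Rightarrow> (nat \<times> nat) multiset set" where
  "parking_biwords n m = {M. parking_mset n (image_mset fst M) \<and> image_mset snd M = m}"

text \<open>Columns are indexed from 0, parking function values from 1.\<close>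

definition biword_columns :: "nat \<Rightarrow> (nat \<times> 'a) multiset \<Rightarrow> 'a multiset list" where
  "biword_columns N M = map (\<lambda>k. {#snd p. p \<in># {#p \<in># M. fst p = Suc k#}#}) [0..<N]"

lemma take_biword_columns:
  assumes "j \<le> N"
  shows "sum_list (take j (biword_columns N M)) = {#snd p. p \<in># {#p \<in># M. 1 \<le> fst p \<and> fst p \<le> j#}#}"
  using assms
proof (induction j)
  case 0
  then show ?case by auto
next
  case (Suc j)
  have "{#p \<in># M. 1 \<le> fst p \<and> fst p \<le> Suc j#} =
     {#p \<in># M. 1 \<le> fst p \<and> fst p \<le> j#} + {#p \<in># M. fst p = Suc j#}"
    by (induction M) auto
  with Suc show ?case by (simp add: biword_columns_def take_Suc_conv_app_nth)
qed

lemma filter_mset_sum: "filter_mset P (sum f A) = (\<Sum>a\<in>A. filter_mset P (f a))"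
  by (induction A rule: infinite_finite_induct) auto

lemma image_mset_sum: "image_mset g (sum f A) = (\<Sum>a\<in>A. image_mset g (f a))"
  by (induction A rule: infinite_finite_induct) auto

text \<open>The number of values at most \<open>j\<close> is the total size of the first
  \<open>j\<close> columns, and \<open>j < 1 + s\<close> means \<open>j \<le> s\<close>. Parking
  values are at most \<open>n\<close>, so the last of the \<open>Suc n\<close> columns is empty; it
  supplies the final letter of the Lukasiewicz word.\<close>

lemma bij_betw_biword_columns:
  "bij_betw (biword_columns (Suc n)) (parking_biwords n m)
     {u. length u = Suc n \<and> sum_list u = m \<and> lukasiewicz 1 u}"
proof -
  \<comment> \<open>The inverse tags the elements of each column with the value of that
    column.\<close>
  define F :: "nat multiset list \<Rightarrow> (nat \<times> nat) multiset"
    where "F = (\<lambda>u. \<Sum>k<length u. image_mset (Pair (Suc k)) (u ! k))"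
  have luk: "u \<in> {u. length u = Suc n \<and> sum_list u = m \<and> lukasiewicz 1 u} \<longleftrightarrow>
      length u = Suc n \<and> sum_list u = m \<and> size m = n \<and> (\<forall>j\<le>n. j \<le> size (sum_list (take j u)))" for u
    by (auto simp: lukasiewicz_iff less_Suc_eq_le)
  have len: "length (biword_columns N M) = N" for N and M :: "(nat \<times> nat) multiset"
    by (simp add: biword_columns_def)
  have part: "size {#x \<in># image_mset fst M. x \<le> j#} = size (sum_list (take j (biword_columns (Suc n) M)))"
    if "\<forall>p\<in>#M. 1 \<le> fst p" "j \<le> Suc n" for M :: "(nat \<times> nat) multiset" and j
  proof -
    have "{#p \<in># M. 1 \<le> fst p \<and> fst p \<le> j#} = {#p \<in># M. fst p \<le> j#}"
      using that(1) by (intro filter_mset_cong) auto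
    then show ?thesis using that(2) by (simp add: take_biword_columns filter_mset_image_mset)
  qed
  have tot: "sum_list (biword_columns (Suc n) M) = image_mset snd M"
    if "\<forall>p\<in>#M. 1 \<le> fst p \<and> fst p \<le> Suc n" for M :: "(nat \<times> nat) multiset"
  proof -
    have "{#p \<in># M. 1 \<le> fst p \<and> fst p \<le> Suc n#} = M"
      using that by (simp add: filter_mset_eq_conv)
    then show ?thesis using take_biword_columns[of "Suc n" "Suc n" M] by (simp add: len)
  qed
  \<comment> \<open>The range ends at \<open>Suc n\<close> rather than \<open>n\<close>, since this
    is all that is known of \<open>F u\<close> before it is shown to be a parking biword.\<close>
  have bi: "M \<in> parking_biwords n m \<longleftrightarrow>
      biword_columns (Suc n) M \<in> {u. length u = Suc n \<and> sum_list u = m \<and> lukasiewicz 1 u}"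
    if M: "\<forall>p\<in>#M. 1 \<le> fst p \<and> fst p \<le> Suc n" for M
  proof -
    have "0 \<notin># image_mset fst M" using M by auto
    then show ?thesis
      unfolding luk parking_biwords_def parking_mset_def using part[of M] tot[OF M] M len
      by auto
  qed
  have in_bi: "\<forall>p\<in>#M. 1 \<le> fst p \<and> fst p \<le> Suc n" if "M \<in> parking_biwords n m" for M
  proof
    fix p assume p: "p \<in># M"
    have pm: "parking_mset n (image_mset fst M)" using that by (simp add: parking_biwords_def)
    have f: "fst p \<in># image_mset fst M" using p by simp
    have "fst p \<noteq> 0" using pm f unfolding parking_mset_def by metis
    with parking_mset_le[OF pm f] show "1 \<le> fst p \<and> fst p \<le> Suc n" by simp
  qed
  have GF: "biword_columns (Suc n) (F u) = u" if "length u = Suc n" for u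
  proof (rule nth_equalityI)
    fix k assume "k < length (biword_columns (Suc n) (F u))"
    then have k: "k < Suc n" by (simp add: len)
    have "biword_columns (Suc n) (F u) ! k = {#snd p. p \<in># {#p \<in># F u. fst p = Suc k#}#}"
      using k by (simp add: biword_columns_def del: upt_Suc)
    also have "\<dots> = (\<Sum>j<Suc n. if j = k then u ! k else {#})"
      unfolding F_def filter_mset_sum image_mset_sum that
      by (rule sum.cong) (auto simp: filter_mset_image_mset multiset.map_comp comp_def)
    also have "\<dots> = u ! k" using k by simp
    finally show "biword_columns (Suc n) (F u) ! k = u ! k" .
  qed (simp add: len that)
  have Fin: "\<forall>p\<in>#F u. 1 \<le> fst p \<and> fst p \<le> Suc n" if "length u = Suc n" for u
    using that by (auto simp: F_def set_mset_sum)
  have sum_fst: "(\<Sum>k<N. {#p \<in># M. fst p = Suc k#}) = {#p \<in># M. 1 \<le> fst p \<and> fst p \<le> N#}"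
    for N and M :: "(nat \<times> nat) multiset"
  proof (induction N)
    case 0
    show ?case by auto
  next
    case (Suc N)
    have "{#p \<in># M. 1 \<le> fst p \<and> fst p \<le> Suc N#} =
       {#p \<in># M. 1 \<le> fst p \<and> fst p \<le> N#} + {#p \<in># M. fst p = Suc N#}"
      by (induction M) auto
    with Suc show ?case by simp
  qed
  have FG: "F (biword_columns (Suc n) M) = M" if M: "\<forall>p\<in>#M. 1 \<le> fst p \<and> fst p \<le> Suc n" for M
  proof -
    have "F (biword_columns (Suc n) M) = (\<Sum>k<Suc n. {#p \<in># M. fst p = Suc k#})"
      unfolding F_def len
    proof (rule sum.cong)
      fix k assume "k \<in> {..<Suc n}"
      then have "image_mset (Pair (Suc k)) (biword_columns (Suc n) M ! k) =
          image_mset (\<lambda>p. (Suc k, snd p)) {#p \<in># M. fst p = Suc k#}"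
        by (simp add: biword_columns_def multiset.map_comp comp_def del: upt_Suc)
      also have "\<dots> = image_mset id {#p \<in># M. fst p = Suc k#}"
        by (rule image_mset_cong) (auto simp: prod_eq_iff)
      finally show "image_mset (Pair (Suc k)) (biword_columns (Suc n) M ! k) = {#p \<in># M. fst p = Suc k#}"
        by simp
    qed simp
    also have "\<dots> = {#p \<in># M. 1 \<le> fst p \<and> fst p \<le> Suc n#}"
      by (rule sum_fst)
    also have "\<dots> = M" using M by (simp add: filter_mset_eq_conv)
    finally show ?thesis .
  qed
  show ?thesis
  proof (rule bij_betw_byWitness[where f' = F])
    show "\<forall>M\<in>parking_biwords n m. F (biword_columns (Suc n) M) = M" using FG in_bi by blast
    show "\<forall>u\<in>{u. length u = Suc n \<and> sum_list u = m \<and> lukasiewicz 1 u}. biword_columns (Suc n) (F u) = u"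
      using GF by blast
    show "biword_columns (Suc n) ` parking_biwords n m \<subseteq> {u. length u = Suc n \<and> sum_list u = m \<and> lukasiewicz 1 u}"
      using bi in_bi by blast
    show "F ` {u. length u = Suc n \<and> sum_list u = m \<and> lukasiewicz 1 u} \<subseteq> parking_biwords n m"
    proof
      fix M assume "M \<in> F ` {u. length u = Suc n \<and> sum_list u = m \<and> lukasiewicz 1 u}"
      then obtain u where u: "M = F u" "u \<in> {u. length u = Suc n \<and> sum_list u = m \<and> lukasiewicz 1 u}"
        by blast
      then show "M \<in> parking_biwords n m" using bi[OF Fin, of u] GF[of u] by auto
    qed
  qed
qed

section \<open>Coefficients of the tree series and of the Frobenius characteristic\<close>

lemma finite_trees: "finite A \<Longrightarrow> finite {t. size t \<le> n \<and> set_tree t \<subseteq> A}"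
proof (induction n)
  case 0
  have "{t :: 'a tree. size t \<le> 0 \<and> set_tree t \<subseteq> A} \<subseteq> {Leaf}" by auto
  then show ?case using finite_subset by blast
next
  case (Suc n)
  let ?S = "{t. size t \<le> n \<and> set_tree t \<subseteq> A}"
  have "{t. size t \<le> Suc n \<and> set_tree t \<subseteq> A} \<subseteq> insert Leaf ((\<lambda>(l, a, r). Node l a r) ` (?S \<times> A \<times> ?S))"
  proof
    fix t assume t: "t \<in> {t. size t \<le> Suc n \<and> set_tree t \<subseteq> A}"
    show "t \<in> insert Leaf ((\<lambda>(l, a, r). Node l a r) ` (?S \<times> A \<times> ?S))"
    proof (cases t)
      case (Node l a r)
      with t have "(l, a, r) \<in> ?S \<times> A \<times> ?S" by simp
      with Node show ?thesis by (intro insertI2 image_eqI[of _ _ "(l, a, r)"]) simp_all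
    qed simp
  qed
  moreover have "finite (insert Leaf ((\<lambda>(l, a, r). Node l a r) ` (?S \<times> A \<times> ?S)))"
    using Suc by simp
  ultimately show ?case by (rule finite_subset)
qed

text \<open>By the convention \<open>0 ^ 0 = 1\<close> the last parameter selects the trees without
  right descents. Their words are exactly the column words of parking biwords; the index 0 is
  separated because it is not a label.\<close>

lemma mcoeff_tree_series:
  "mcoeff (tree_series n 1 1 1 0) m =
    (if 0 \<in># m then 0 else of_nat (card (parking_biwords n m)) :: rat)"
proof -
  let ?L = "{T. T \<in> labeled_trees n \<and> mset_tree T = m}"
  have fin: "finite ?L"
    by (rule finite_subset[OF _ finite_trees[of "set_mset m" n]]) (auto simp: labeled_trees_def)
  have "mcoeff (tree_series n 1 1 1 0) m = (\<Sum>T\<in>?L. if rdes T = 0 then 1 else 0 :: rat)"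
    by (auto simp: tree_series_def intro!: sum.cong)
  also have "\<dots> = of_nat (card {T \<in> ?L. rdes T = 0})"
    using fin by (simp add: sum.If_cases Int_def)
  also have "\<dots> = (if 0 \<in># m then 0 else of_nat (card (parking_biwords n m)))"
  proof (cases "0 \<in># m")
    case True
    then have "{T \<in> ?L. rdes T = 0} = {}" by (force simp: labeled_trees_def)
    then have "card {T \<in> ?L. rdes T = 0} = 0" by (simp only: card.empty)
    with True show ?thesis by simp
  next
    case False
    then have "{T \<in> ?L. rdes T = 0} = {t. rdes t = 0 \<and> size t = n \<and> mset_tree t = m}"
      by (auto simp: labeled_trees_def Suc_le_eq simp flip: set_mset_tree intro: gr0I)
    then show ?thesis
      using False bij_betw_same_card[OF bij_betw_tree_code[of n m]] bij_betw_same_card[OF bij_betw_biword_columns[of n m]]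
      by simp
  qed
  finally show ?thesis .
qed

lemma finite_parking_functions: "finite (parking_functions n)"
proof (rule finite_subset)
  show "parking_functions n \<subseteq> {a. set a \<subseteq> {..n} \<and> length a = n}"
  proof
    fix a assume "a \<in> parking_functions n"
    then have a: "parking_mset n (mset a)" by (simp add: parking_functions_iff)
    then have "length a = n" by (simp add: parking_mset_def)
    moreover have "set a \<subseteq> {..n}" using parking_mset_le[OF a] by auto
    ultimately show "a \<in> {a. set a \<subseteq> {..n} \<and> length a = n}" by simp
  qed
qed (simp add: finite_lists_length_eq)

text \<open>Zipping commutes with permuting positions, so \<open>w\<close> fixes
  \<open>zip a c\<close> exactly when it fixes both words. The product of two fixed point counts
  thus becomes a single one, ready for Burnside's lemma.\<close>

lemma card_fixed_biwords:
  assumes w: "w \<in> perms n" and m: "0 \<notin># m"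
  shows "card {a \<in> parking_functions n. permute_list w a = a} *
      card {c. length c = n \<and> (\<forall>k\<in>set c. 1 \<le> k) \<and> mset c = m \<and> permute_list w c = c} =
    card {z. length z = n \<and> mset z \<in> parking_biwords n m \<and> permute_list w z = z}"
proof -
  let ?A = "{a \<in> parking_functions n. permute_list w a = a}"
  let ?C = "{c. length c = n \<and> (\<forall>k\<in>set c. 1 \<le> k) \<and> mset c = m \<and> permute_list w c = c}"
  let ?Z = "{z. length z = n \<and> mset z \<in> parking_biwords n m \<and> permute_list w z = z}"
  have w': "w permutes {..<n}" using w by (simp add: perms_def)
  have "bij_betw (\<lambda>(a, c). zip a c) (?A \<times> ?C) ?Z"
  proof (rule bij_betw_byWitness[where f' = "\<lambda>z. (map fst z, map snd z)"])
    have len: "length a = n" if "a \<in> parking_functions n" for a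
      using that by (simp add: parking_functions_def)
    show "\<forall>x\<in>?A \<times> ?C. (\<lambda>z. (map fst z, map snd z)) ((\<lambda>(a, c). zip a c) x) = x"
      using len by auto
    show "\<forall>z\<in>?Z. (\<lambda>(a, c). zip a c) ((\<lambda>z. (map fst z, map snd z)) z) = z"
      by (simp add: zip_map_fst_snd)
    show "(\<lambda>(a, c). zip a c) ` (?A \<times> ?C) \<subseteq> ?Z"
      using len w' by (auto simp: parking_biwords_def parking_functions_iff permute_list_zip
          simp flip: mset_map)
    show "(\<lambda>z. (map fst z, map snd z)) ` ?Z \<subseteq> ?A \<times> ?C"
    proof
      fix x assume "x \<in> (\<lambda>z. (map fst z, map snd z)) ` ?Z"
      then obtain z where z: "x = (map fst z, map snd z)" "length z = n"
        "mset z \<in> parking_biwords n m" "permute_list w z = z" by blast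
      have "permute_list w (map f z) = map f z" for f :: "nat \<times> nat \<Rightarrow> nat"
        using permute_list_map[of w z f] w' z by simp
      moreover have "1 \<le> k" if "k \<in># m" for k
        using m that by (metis less_one not_le)
      ultimately show "x \<in> ?A \<times> ?C"
        using z by (auto simp: parking_biwords_def parking_functions_iff simp flip: set_mset_mset)
    qed
  qed
  from bij_betw_same_card[OF this] show ?thesis by (simp add: card_cartesian_product)
qed

lemma sum_card_fixed_biwords:
  "(\<Sum>w\<in>perms n. card {z. length z = n \<and> mset z \<in> parking_biwords n m \<and> permute_list w z = z}) =
    fact n * card (parking_biwords n m)"
proof -
  have "{M \<in> parking_biwords n m. size M = n} = parking_biwords n m"
    by (auto simp: parking_biwords_def parking_mset_def)
  moreover have "finite {z. length z = n \<and> mset z \<in> parking_biwords n m}"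
  proof (rule finite_subset)
    show "{z. length z = n \<and> mset z \<in> parking_biwords n m} \<subseteq>
        {z. set z \<subseteq> {..n} \<times> set_mset m \<and> length z = n}"
    proof
      fix z assume "z \<in> {z. length z = n \<and> mset z \<in> parking_biwords n m}"
      then have len: "length z = n" and pm: "parking_mset n (image_mset fst (mset z))"
        and m: "image_mset snd (mset z) = m" by (auto simp: parking_biwords_def)
      have "fst p \<le> n" "snd p \<in># m" if "p \<in> set z" for p
        using that parking_mset_le[OF pm, of "fst p"] m by auto
      then have "set z \<subseteq> {..n} \<times> set_mset m" by (auto simp: subset_iff)
      with len show "z \<in> {z. set z \<subseteq> {..n} \<times> set_mset m \<and> length z = n}" by simp
    qed
  qed (simp add: finite_lists_length_eq)
  ultimately show ?thesis using burnside_lists[of n "parking_biwords n m"] by simp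
qed

lemma permute_list_inv_eq_iff:
  assumes "w permutes {..<length a}"
  shows "permute_list (inv w) a = a \<longleftrightarrow> permute_list w a = a"
proof -
  have "permute_list w (permute_list (inv w) a) = a"
    using permute_list_compose[of w a "inv w"] assms permutes_inv_o(2)[OF assms] by simp
  moreover have "permute_list (inv w) (permute_list w a) = a"
    using permute_list_compose[of "inv w" a w] assms permutes_inv[OF assms] permutes_inv_o(1)[OF assms] by simp
  ultimately show ?thesis by metis
qed

text \<open>The trace of a permutation matrix counts fixed points, and \<open>\<phi>\<close> carries
  these to fixed parking functions. The inverse in \<open>parking_action\<close> does no harm, as
  \<open>w\<close> and \<open>inv w\<close> fix the same words.\<close>

lemma perm_character_transport:
  assumes \<phi>: "bij_betw \<phi> X (parking_functions n)" and w: "w \<in> perms n"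
  shows "perm_character X (transport_action X \<phi> parking_action) w =
    of_nat (card {a \<in> parking_functions n. permute_list w a = a})"
proof -
  have fin: "finite X" using bij_betw_finite[OF \<phi>] finite_parking_functions by simp
  have w': "w permutes {..<length a}" if "a \<in> parking_functions n" for a
    using that w by (simp add: parking_functions_def perms_def)
  have act: "parking_action w a \<in> parking_functions n" if "a \<in> parking_functions n" for a
    using that permutes_inv[OF w'[OF that]] by (simp add: parking_action_def parking_functions_iff)
  have "x = transport_action X \<phi> parking_action w x \<longleftrightarrow> permute_list w (\<phi> x) = \<phi> x" if "x \<in> X" for x
  proof -
    have px: "\<phi> x \<in> parking_functions n" using that \<phi> bij_betwE by blast
    have "x = transport_action X \<phi> parking_action w x \<longleftrightarrow> \<phi> x = parking_action w (\<phi> x)"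
      unfolding transport_action_def using \<phi> that act[OF px]
      by (metis bij_betw_imp_surj_on bij_betw_inv_into_left f_inv_into_f)
    then show ?thesis
      using permute_list_inv_eq_iff[OF w'[OF px]] by (auto simp: parking_action_def)
  qed
  then have "perm_character X (transport_action X \<phi> parking_action) w =
      (\<Sum>x\<in>X. if permute_list w (\<phi> x) = \<phi> x then 1 else 0)"
    unfolding perm_character_def perm_rep_def by (intro sum.cong) auto
  also have "\<dots> = (\<Sum>a\<in>parking_functions n. if permute_list w a = a then 1 else 0)"
    by (rule sum.reindex_bij_betw[OF \<phi>])
  also have "\<dots> = of_nat (card {a \<in> parking_functions n. permute_list w a = a})"
    using finite_parking_functions by (simp add: sum.If_cases Int_def)
  finally show ?thesis .
qed

text \<open>Only numbers of fixed points enter the characteristic, so the choice of the bijection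
  \<open>\<phi>\<close> drops out.\<close>

lemma frobenius_char_parking_action:
  assumes "bij_betw \<phi> X (parking_functions n)"
  shows "frobenius_char_action n X (transport_action X \<phi> parking_action) = tree_series n 1 1 1 0"
proof (rule mseries_eqI)
  fix m :: "nat multiset"
  let ?C = "\<lambda>w. {c. length c = n \<and> (\<forall>k\<in>set c. 1 \<le> k) \<and> mset c = m \<and> permute_list w c = c}"
  let ?A = "\<lambda>w. {a \<in> parking_functions n. permute_list w a = a}"
  have "mcoeff (frobenius_char_action n X (transport_action X \<phi> parking_action)) m =
      1 / fact n * (\<Sum>w\<in>perms n. of_nat (card (?A w) * card (?C w)))"
    unfolding frobenius_char_action_def frobenius_char_def mcoeff_mconst_times mcoeff_sum
    by (intro arg_cong2[of _ _ _ _ "(*)"] sum.cong refl)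
      (simp add: perm_character_transport[OF assms] mcoeff_power_sums_cycle_type perms_def)
  also have "\<dots> = mcoeff (tree_series n 1 1 1 0) m"
  proof (cases "0 \<in># m")
    case True
    then have "?C w = {}" for w by force
    then have "card (?C w) = 0" for w by (simp only: card.empty)
    with True show ?thesis by (simp add: mcoeff_tree_series)
  next
    case False
    have "(\<Sum>w\<in>perms n. of_nat (card (?A w) * card (?C w)) :: rat) =
        of_nat (fact n * card (parking_biwords n m))"
      using card_fixed_biwords[OF _ False, of _ n] sum_card_fixed_biwords[of n m]
      by (simp flip: of_nat_sum)
    with False show ?thesis by (simp add: mcoeff_tree_series)
  qed
  finally show "mcoeff (frobenius_char_action n X (transport_action X \<phi> parking_action)) m =
      mcoeff (tree_series n 1 1 1 0) m" .
qed

section \<open>Parking functions and sign patterns\<close>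

definition pos :: "nat set \<Rightarrow> (nat \<Rightarrow> real) \<Rightarrow> nat \<Rightarrow> nat" where
  "pos A x i = card {j \<in> A. x i < x j}"

text \<open>The bound \<open>x i \<le> x j + 1\<close> is weak, so that the elements of a chain may be spaced by exactly 1.\<close>

definition close_pair :: "nat \<Rightarrow> (nat \<Rightarrow> real) \<Rightarrow> nat \<Rightarrow> nat \<Rightarrow> bool" where
  "close_pair n x i j \<longleftrightarrow> i < j \<and> j < n \<and> x j < x i \<and> x i \<le> x j + 1"

definition chain_arc :: "nat \<Rightarrow> (nat \<Rightarrow> real) \<Rightarrow> nat \<Rightarrow> nat \<Rightarrow> bool" where
  "chain_arc n x i j \<longleftrightarrow> close_pair n x i j \<and>
     (\<forall>a b. close_pair n x a b \<and> x i \<le> x a \<and> x b \<le> x j \<longrightarrow> a = i \<and> b = j)"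

definition first_in_block :: "(nat \<Rightarrow> nat) \<Rightarrow> nat \<Rightarrow> bool" where
  "first_in_block f i \<longleftrightarrow> (\<forall>k<i. f k \<noteq> f i)"

definition next_in_block :: "nat \<Rightarrow> (nat \<Rightarrow> nat) \<Rightarrow> nat \<Rightarrow> nat \<Rightarrow> bool" where
  "next_in_block n f i j \<longleftrightarrow> i < j \<and> j < n \<and> f i = f j \<and> (\<forall>k. i < k \<and> k < j \<longrightarrow> f k \<noteq> f j)"

text \<open>
  The Athanasiadis--Linusson correspondence, with \<open>f i = a\<^sub>i - 1\<close> for a parking function \<open>a\<close>:
  list the coordinates in decreasing order, join pairs \<open>i < j\<close> with \<open>x\<^sub>i - x\<^sub>j\<close> in \<open>(0, 1]\<close> that are
  maximal for inclusion of the intervals \<open>[x\<^sub>j, x\<^sub>i]\<close>, and let \<open>f\<close> be constant on the resulting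
  chains, with value the number of coordinates above the top of the chain.
\<close>

definition represents :: "nat \<Rightarrow> (nat \<Rightarrow> nat) \<Rightarrow> (nat \<Rightarrow> real) \<Rightarrow> bool" where
  "represents n f x \<longleftrightarrow> inj_on x {..<n} \<and> chain_arc n x = next_in_block n f \<and>
     (\<forall>i<n. first_in_block f i \<longrightarrow> f i = pos {..<n} x i)"

text \<open>For a < b, the pair (a, b) records x_a - x_b > 1 and the pair (b, a) records x_a - x_b <
  0. A point with x_a - x_b = 1 goes with the side below 1, in agreement with the weak bound in
  \<open>close_pair\<close>.\<close>

definition pattern :: "nat \<Rightarrow> (nat \<Rightarrow> real) \<Rightarrow> (nat \<times> nat) set" where
  "pattern n x = {(j, i). i < n \<and> j < n \<and> x i + (if j < i then 1 else 0) < x j}"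

section \<open>Positions and maximal close pairs\<close>

lemma pos_less_iff:
  assumes "finite A" "inj_on x A" "i \<in> A" "j \<in> A"
  shows "pos A x i < pos A x j \<longleftrightarrow> x j < x i"
proof -
  have *: "pos A x i < pos A x j" if "x j < x i" "i \<in> A" for i j
    unfolding pos_def using that assms(1) by (intro psubset_card_mono) (auto simp: psubset_eq set_eq_iff intro!: exI[of _ i])
  show ?thesis
    using *[of j i] *[of i j] assms by (cases "x i" "x j" rule: linorder_cases) (auto dest: inj_onD)
qed

lemma pos_less: "finite A \<Longrightarrow> i \<in> A \<Longrightarrow> pos A x i < card A"
  unfolding pos_def by (intro psubset_card_mono) auto

lemma bij_betw_pos:
  assumes "finite A" "inj_on x A"
  shows "bij_betw (pos A x) A {..<card A}"
proof -
  have inj: "inj_on (pos A x) A"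
  proof (rule inj_onI)
    fix i j assume ij: "i \<in> A" "j \<in> A" "pos A x i = pos A x j"
    then have "\<not> x i < x j" "\<not> x j < x i"
      using pos_less_iff[OF assms ij(1,2)] pos_less_iff[OF assms ij(2,1)] by auto
    with ij assms(2) show "i = j" by (auto dest: inj_onD)
  qed
  moreover have "pos A x ` A = {..<card A}"
    by (rule card_subset_eq) (use pos_less assms card_image[OF inj] in auto)
  ultimately show ?thesis by (simp add: bij_betw_def)
qed

lemma ex_pos: "finite A \<Longrightarrow> inj_on x A \<Longrightarrow> q < card A \<Longrightarrow> \<exists>i\<in>A. pos A x i = q"
  using bij_betw_pos[of A x] unfolding bij_betw_def by (metis imageE lessThan_iff)

lemma pos_eq_iff:
  "finite A \<Longrightarrow> inj_on x A \<Longrightarrow> i \<in> A \<Longrightarrow> j \<in> A \<Longrightarrow> pos A x i = pos A x j \<longleftrightarrow> i = j"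
  using bij_betw_pos[of A x] unfolding bij_betw_def by (blast dest: inj_onD)

text \<open>Two arcs with a common end have nested intervals, so maximality identifies them. The
  same nesting argument gives the next two lemmas.\<close>

lemma chain_arc_out_unique: "chain_arc n x i j \<Longrightarrow> chain_arc n x i j' \<Longrightarrow> j = j'"
  unfolding chain_arc_def by (metis linear order_refl)

lemma chain_arc_in_unique: "chain_arc n x i j \<Longrightarrow> chain_arc n x i' j \<Longrightarrow> i = i'"
  unfolding chain_arc_def by (metis linear order_refl)

lemma chain_arc_nonnesting: "chain_arc n x i j \<Longrightarrow> chain_arc n x i' j' \<Longrightarrow> x i' < x i \<Longrightarrow> x j' < x j"
  unfolding chain_arc_def by (metis linorder_not_less less_imp_le less_irrefl)

lemma chain_arc_less: "chain_arc n x i j \<Longrightarrow> i < j \<and> j < n \<and> x j < x i"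
  by (simp add: chain_arc_def close_pair_def)

text \<open>Among the close pairs whose interval contains the given one, a longest is an arc;
  injectivity turns equal end values into equal indices.\<close>

lemma chain_arc_above_close:
  assumes "inj_on x {..<n}" "close_pair n x i j"
  obtains a b where "chain_arc n x a b" "x i \<le> x a" "x b \<le> x j"
proof -
  define S where "S = {(a, b). close_pair n x a b \<and> x i \<le> x a \<and> x b \<le> x j}"
  have "S \<subseteq> {..<n} \<times> {..<n}" by (auto simp: S_def close_pair_def)
  then have "finite S" by (rule finite_subset) simp
  moreover have "(i, j) \<in> S" using assms by (simp add: S_def)
  ultimately have max: "Max ((\<lambda>(a, b). x a - x b) ` S) \<in> (\<lambda>(a, b). x a - x b) ` S"
    and max_ge: "\<And>c d. (c, d) \<in> S \<Longrightarrow> x c - x d \<le> Max ((\<lambda>(a, b). x a - x b) ` S)"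
    by (auto intro: Max_in intro!: Max_ge)
  from max obtain a b where ab: "(a, b) \<in> S" "Max ((\<lambda>(a, b). x a - x b) ` S) = x a - x b" by auto
  have "c = a \<and> d = b" if "close_pair n x c d" "x a \<le> x c" "x d \<le> x b" for c d
  proof -
    have "(c, d) \<in> S" using that ab(1) by (auto simp: S_def)
    with max_ge[of c d] ab(2) that have "x c = x a" "x d = x b" by auto
    moreover have "a < n" "b < n" "c < n" "d < n" using that ab(1) by (auto simp: S_def close_pair_def)
    ultimately show ?thesis using assms(1) by (auto dest: inj_onD)
  qed
  with ab(1) have "chain_arc n x a b" "x i \<le> x a" "x b \<le> x j" by (auto simp: S_def chain_arc_def)
  then show thesis by (rule that)
qed

text \<open>Hence the arcs and the order of the coordinates determine all close pairs, and by
  \<open>pattern_iff\<close> the whole pattern.\<close>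

lemma close_pair_iff_arc:
  assumes "inj_on x {..<n}"
  shows "close_pair n x i j \<longleftrightarrow> i < j \<and> j < n \<and> x j < x i \<and> (\<exists>a b. chain_arc n x a b \<and> x i \<le> x a \<and> x b \<le> x j)"
proof
  assume "close_pair n x i j"
  with chain_arc_above_close[OF assms this] show "i < j \<and> j < n \<and> x j < x i \<and> (\<exists>a b. chain_arc n x a b \<and> x i \<le> x a \<and> x b \<le> x j)"
    unfolding close_pair_def by metis
qed (auto simp: chain_arc_def close_pair_def)

lemma pattern_iff:
  "(j, i) \<in> pattern n x \<longleftrightarrow> i < n \<and> j < n \<and> x i < x j \<and> \<not> close_pair n x j i"
  by (auto simp: pattern_def close_pair_def)

section \<open>Blocks of a function and chains of a point\<close>

lemma next_in_blockE:
  assumes "i < n" "\<not> first_in_block f i"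
  obtains p where "next_in_block n f p i"
proof -
  let ?S = "{k. k < i \<and> f k = f i}"
  have S: "finite ?S" "?S \<noteq> {}" using assms(2) by (auto simp: first_in_block_def)
  then have M: "Max ?S \<in> ?S" by (rule Max_in)
  have no:  "f k \<noteq> f i" if "Max ?S < k" "k < i" for k
    using that S(1) Max_ge[of ?S k] by fastforce
  have "next_in_block n f (Max ?S) i"
    unfolding next_in_block_def using M no assms(1) by blast
  then show thesis by (rule that)
qed

lemma next_in_block_first: "next_in_block n f p i \<Longrightarrow> \<not> first_in_block f i"
  by (auto simp: next_in_block_def first_in_block_def)

text \<open>Arcs increase the index, so \<open>f\<close> can be built one index at a time: a value
  is copied along the unique incoming arc, and a chain top receives its own position.\<close>

lemma ex_chain_top:
  assumes "m \<le> n"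
  shows "\<exists>f. \<forall>i<m. (\<forall>p. chain_arc n x p i \<longrightarrow> f i = f p) \<and> ((\<nexists>p. chain_arc n x p i) \<longrightarrow> f i = pos {..<n} x i)"
  using assms
proof (induction m)
  case (Suc m)
  then have "m \<le> n" by simp
  from Suc.IH[OF this] obtain f where
    "\<forall>i<m. (\<forall>p. chain_arc n x p i \<longrightarrow> f i = f p) \<and> ((\<nexists>p. chain_arc n x p i) \<longrightarrow> f i = pos {..<n} x i)" by blast
  then have f: "\<And>i p. i < m \<Longrightarrow> chain_arc n x p i \<Longrightarrow> f i = f p"
    "\<And>i. i < m \<Longrightarrow> (\<nexists>p. chain_arc n x p i) \<Longrightarrow> f i = pos {..<n} x i" by blast+
  define g where "g = f(m := if \<exists>p. chain_arc n x p m then f (THE p. chain_arc n x p m) else pos {..<n} x m)"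
  have "g i = g p" if "i < Suc m" "chain_arc n x p i" for i p
  proof (cases "i = m")
    case True
    with that have "(THE p. chain_arc n x p m) = p" by (blast intro: the_equality chain_arc_in_unique)
    with that True chain_arc_less[OF that(2)] show ?thesis by (auto simp: g_def)
  next
    case False
    with that f(1)[of i p] chain_arc_less[OF that(2)] show ?thesis by (auto simp: g_def)
  qed
  moreover have "g i = pos {..<n} x i" if "i < Suc m" "\<nexists>p. chain_arc n x p i" for i
    using that f(2)[of i] by (auto simp: g_def less_Suc_eq)
  ultimately show ?case by blast
qed simp

text \<open>The level sets of \<open>f\<close> must be exactly the chains. This works because
  different tops have different positions, so different chains get different values.\<close>

lemma ex_represents_of_point:
  assumes inj: "inj_on x {..<n}"
  obtains f where "represents n f x" "\<And>k. k \<le> n \<Longrightarrow> k \<le> card {i. i < n \<and> f i < k}"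
proof -
  have inj': "finite {..<n}" "inj_on x {..<n}" using inj by auto
  obtain f where f_arc: "\<And>i p. chain_arc n x p i \<Longrightarrow> f i = f p"
    and f_top: "\<And>i. i < n \<Longrightarrow> (\<nexists>p. chain_arc n x p i) \<Longrightarrow> f i = pos {..<n} x i"
    using ex_chain_top[of n n x] chain_arc_less by (metis order_refl)
  \<comment> \<open>\<open>r\<close> is the top of the chain of \<open>i\<close>; index and position
    both grow along a chain.\<close>
  have top: "\<exists>r\<le>i. f i = pos {..<n} x r \<and> pos {..<n} x r \<le> pos {..<n} x i" if "i < n" for i
    using that
  proof (induction i rule: less_induct)
    case (less i)
    show ?case
    proof (cases "\<exists>p. chain_arc n x p i")
      case True
      then obtain p where p: "chain_arc n x p i" by blast
      with chain_arc_less[OF p] less.IH[of p] less.prems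
      obtain r where r: "r \<le> p" "f p = pos {..<n} x r" "pos {..<n} x r \<le> pos {..<n} x p" by auto
      moreover have "pos {..<n} x p < pos {..<n} x i"
        using chain_arc_less[OF p] less.prems by (subst pos_less_iff[OF inj']) auto
      ultimately show ?thesis using f_arc[OF p] chain_arc_less[OF p] by (intro exI[of _ r]) auto
    next
      case False
      with f_top less.prems show ?thesis by auto
    qed
  qed
  have pos_inj: "i = j" if "pos {..<n} x i = pos {..<n} x j" "i < n" "j < n" for i j
    using that pos_eq_iff[OF inj', of i j] by simp
  \<comment> \<open>Without an incoming arc \<open>f j\<close> would be the position of
    \<open>j\<close> itself, while \<open>f i\<close> is the position of some index at most
    \<open>i\<close>.\<close>
  have pred: "\<exists>p. chain_arc n x p j" if "i < j" "j < n" "f i = f j" for i j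
  proof (rule ccontr)
    assume "\<nexists>p. chain_arc n x p j"
    with f_top that have "f i = pos {..<n} x j" by simp
    with top[of i] that obtain r where "r \<le> i" "pos {..<n} x r = pos {..<n} x j" by auto
    with pos_inj[of r j] that show False by simp
  qed
  \<comment> \<open>Walking back from \<open>j\<close> along incoming arcs must meet
    \<open>i\<close>: jumping over \<open>i\<close> would give some \<open>p\<close> two outgoing
    arcs.\<close>
  have succ: "\<exists>j'\<le>j. chain_arc n x i j'" if "i < j" "j < n" "f i = f j" for i j
    using that
  proof (induction j arbitrary: i rule: less_induct)
    case (less j)
    obtain p where p: "chain_arc n x p j" using pred less.prems by blast
    note pj = chain_arc_less[OF p] f_arc[OF p]
    consider "p = i" | "i < p" | "p < i" by linarith
    then show ?case
    proof cases
      case 1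
      with p show ?thesis by blast
    next
      case 2
      with less.IH[of p i] less.prems pj obtain j' where "j' \<le> p" "chain_arc n x i j'" by auto
      with pj show ?thesis by (intro exI[of _ j']) auto
    next
      case 3
      with less.IH[of i p] less.prems pj obtain j' where "j' \<le> i" "chain_arc n x p j'" by auto
      with chain_arc_out_unique[OF p] less.prems show ?thesis by force
    qed
  qed
  have "chain_arc n x i j \<longleftrightarrow> next_in_block n f i j" for i j
  proof
    assume a: "chain_arc n x i j"
    have "f k \<noteq> f j" if "i < k" "k < j" for k
    proof
      assume "f k = f j"
      with succ[of i k] that f_arc[OF a] chain_arc_less[OF a] obtain j' where "j' \<le> k" "chain_arc n x i j'" by auto
      with chain_arc_out_unique[OF a] that show False by force
    qed
    with chain_arc_less[OF a] f_arc[OF a] show "next_in_block n f i j" by (auto simp: next_in_block_def)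
  next
    assume b: "next_in_block n f i j"
    with succ[of i j] obtain j' where j': "j' \<le> j" "chain_arc n x i j'" by (auto simp: next_in_block_def)
    have "j' = j"
    proof (rule ccontr)
      assume "j' \<noteq> j"
      with j' chain_arc_less[OF j'(2)] b have "f j' \<noteq> f j" by (auto simp: next_in_block_def)
      with f_arc[OF j'(2)] b show False by (auto simp: next_in_block_def)
    qed
    with j' show "chain_arc n x i j" by simp
  qed
  then have arcs: "chain_arc n x = next_in_block n f" by blast
  have "f i = pos {..<n} x i" if "i < n" "first_in_block f i" for i
    using f_top[OF that(1)] next_in_block_first[of n f _ i] that(2) arcs by auto
  with arcs inj have "represents n f x" by (simp add: represents_def)
  \<comment> \<open>Values of \<open>f\<close> never exceed positions, and the positions are 0, ...,
    n - 1 in some order.\<close>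
  moreover have "k \<le> card {i. i < n \<and> f i < k}" if "k \<le> n" for k
  proof -
    have "{..<k} \<subseteq> pos {..<n} x ` {i. i < n \<and> pos {..<n} x i < k}"
    proof
      fix q assume q: "q \<in> {..<k}"
      with that have "q < card {..<n}" by simp
      from ex_pos[OF inj' this] q show "q \<in> pos {..<n} x ` {i. i < n \<and> pos {..<n} x i < k}" by auto
    qed
    from surj_card_le[OF _ this] have "k \<le> card {i. i < n \<and> pos {..<n} x i < k}" by simp
    also have "\<dots> \<le> card {i. i < n \<and> f i < k}"
    proof (rule card_mono)
      show "{i. i < n \<and> pos {..<n} x i < k} \<subseteq> {i. i < n \<and> f i < k}"
        using top le_less_trans by fastforce
    qed simp
    finally show ?thesis .
  qed
  ultimately show thesis by (rule that)
qed

text \<open>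
  Scanning the positions from the top, the next element is either the first of its block, whose
  position is known, or the successor of the highest element with a pending arc, as arcs do not nest.
\<close>

lemma represents_pos_eq:
  assumes x: "represents n f x" and y: "represents n f y"
  shows "i < n \<Longrightarrow> pos {..<n} x i = pos {..<n} y i"
proof -
  let ?px = "pos {..<n} x" and ?py = "pos {..<n} y"
  have inj: "finite {..<n}" "inj_on x {..<n}" "inj_on y {..<n}"
    using x y by (auto simp: represents_def)
  have arcs: "chain_arc n x = next_in_block n f" "chain_arc n y = next_in_block n f"
    using x y by (auto simp: represents_def)
  have key: "\<forall>i<n. ?px i = q \<longleftrightarrow> ?py i = q" for q
  proof (induction q rule: less_induct)
    case (less q)
    have IH: "?px k < q \<longleftrightarrow> ?py k < q" "?px k < q \<Longrightarrow> ?px k = ?py k" "?py k < q \<Longrightarrow> ?px k = ?py k"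
      if "k < n" for k
      using less that by metis+
    show ?case
    proof (cases "q < n")
      case False
      then show ?thesis using pos_less[OF inj(1)] by fastforce
    next
      case True
      then obtain i where i: "i < n" "?px i = q" using ex_pos[OF inj(1,2), of q] by auto
      obtain i' where i': "i' < n" "?py i' = q" using True ex_pos[OF inj(1,3), of q] by auto
      have "i = i'"
      proof (cases "first_in_block f i \<or> first_in_block f i'")
        case True
        then have "?py i = q \<or> ?px i' = q" using x y i i' by (force simp: represents_def)
        then show ?thesis using i i' pos_eq_iff[OF inj(1,2), of i i'] pos_eq_iff[OF inj(1,3), of i i'] by auto
      next
        case False
        then obtain p p' where p: "next_in_block n f p i" and p': "next_in_block n f p' i'"
          using next_in_blockE i(1) i'(1) by metis
        note ax = p[folded arcs(1)] p'[folded arcs(1)] and ay = p[folded arcs(2)] p'[folded arcs(2)]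
        have n: "p < n" "p' < n" using chain_arc_less[OF ax(1)] chain_arc_less[OF ax(2)] by auto
        have "?px p < q" using pos_less_iff[OF inj(1,2), of p i] chain_arc_less[OF ax(1)] i n by auto
        then have eq: "?px p = ?py p" using IH n by blast
        have "?py p' < q" using pos_less_iff[OF inj(1,3), of p' i'] chain_arc_less[OF ay(2)] i' n by auto
        then have eq': "?px p' = ?py p'" using IH n by blast
        \<comment> \<open>Here \<open>i\<close> and \<open>i'\<close> hold position \<open>q\<close>
          in \<open>x\<close> and \<open>y\<close>. If \<open>p\<close> were above
          \<open>p'\<close>, in both points by induction, then \<open>i\<close> would be above
          \<open>i'\<close> in \<open>y\<close>, at a position below \<open>q\<close>, where both
          points agree.\<close>
        have "\<not> x p' < x p"
        proof
          assume "x p' < x p"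
          then have "?px p < ?px p'" using pos_less_iff[OF inj(1,2), of p p'] n by simp
          then have "y p' < y p" using pos_less_iff[OF inj(1,3), of p p'] n eq eq' by simp
          then have "y i' < y i" by (rule chain_arc_nonnesting[OF ay])
          then have "?py i < q" using pos_less_iff[OF inj(1,3), of i i'] i i' by simp
          then show False using IH[of i] i by simp
        qed
        moreover have "\<not> x p < x p'"
        proof
          assume "x p < x p'"
          then have "x i < x i'" by (rule chain_arc_nonnesting[OF ax(2,1)])
          then have "?px i' < q" using pos_less_iff[OF inj(1,2), of i' i] i i' by simp
          then show False using IH[of i'] i' by simp
        qed
        ultimately have "p = p'" using inj(2) n by (auto dest: inj_onD)
        then show ?thesis using ax chain_arc_out_unique by blast
      qed
      then show ?thesis using i i' pos_eq_iff[OF inj(1,2)] pos_eq_iff[OF inj(1,3)] by (metis lessThan_iff)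
    qed
  qed
  show "i < n \<Longrightarrow> ?px i = ?py i" using key by blast
qed

text \<open>\<open>f\<close> fixes the positions, hence the order, and also the arcs; these two
  determine the close pairs and so the pattern.\<close>

lemma represents_pattern_eq:
  assumes x: "represents n f x" and y: "represents n f y"
  shows "pattern n x = pattern n y"
proof -
  have inj: "finite {..<n}" "inj_on x {..<n}" "inj_on y {..<n}"
    using x y by (auto simp: represents_def)
  have arcs: "chain_arc n x = chain_arc n y"
    using x y by (simp add: represents_def)
  have order: "x i < x j \<longleftrightarrow> y i < y j" if "i < n" "j < n" for i j
    using that represents_pos_eq[OF x y] pos_less_iff[OF inj(1,2), of j i] pos_less_iff[OF inj(1,3), of j i]
    by simp
  have "close_pair n x i j \<longleftrightarrow> close_pair n y i j" for i j
  proof (cases "i < j \<and> j < n")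
    case True
    have "chain_arc n x a b \<and> x i \<le> x a \<and> x b \<le> x j \<longleftrightarrow> chain_arc n y a b \<and> y i \<le> y a \<and> y b \<le> y j" for a b
      using True order[of a i] order[of j b] arcs chain_arc_less[of n y a b] by (auto simp flip: not_less)
    with True order[of j i] show ?thesis
      unfolding close_pair_iff_arc[OF inj(2)] close_pair_iff_arc[OF inj(3)] by simp
  qed (auto simp: close_pair_def)
  then show ?thesis using order by (auto simp: pattern_iff)
qed

text \<open>The pattern gives back the order and the close pairs, hence positions and arcs. A value
  of \<open>f\<close> is then read off at the first element of a block and copied along it.\<close>

lemma represents_unique:
  assumes x: "represents n f x" and y: "represents n g y" and p: "pattern n x = pattern n y"
  shows "i < n \<Longrightarrow> f i = g i"
proof -
  have inj: "finite {..<n}" "inj_on x {..<n}" "inj_on y {..<n}"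
    using x y by (auto simp: represents_def)
  have up: "x i < x j \<longleftrightarrow> y i < y j" if "i < j" "j < n" for i j
  proof -
    have "x i < x j \<longleftrightarrow> (j, i) \<in> pattern n x" "y i < y j \<longleftrightarrow> (j, i) \<in> pattern n y"
      using that by (auto simp: pattern_def)
    with p show ?thesis by simp
  qed
  have neq: "x i \<noteq> x j" "y i \<noteq> y j" if "i < n" "j < n" "i \<noteq> j" for i j
    using inj that by (auto dest: inj_onD)
  have order: "x i < x j \<longleftrightarrow> y i < y j" if "i < n" "j < n" for i j
    using up[of i j] up[of j i] neq[of i j] that by (cases i j rule: linorder_cases) auto
  have close_pair: "close_pair n x i j \<longleftrightarrow> close_pair n y i j" for i j
  proof (cases "i < j \<and> j < n")
    case True
    then have "close_pair n x i j \<longleftrightarrow> x j < x i \<and> (i, j) \<notin> pattern n x"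
      "close_pair n y i j \<longleftrightarrow> y j < y i \<and> (i, j) \<notin> pattern n y"
      by (auto simp: pattern_def close_pair_def)
    with True order[of j i] p show ?thesis by simp
  qed (auto simp: close_pair_def)
  have "chain_arc n x i j \<longleftrightarrow> chain_arc n y i j" for i j
  proof (cases "i < n \<and> j < n")
    case True
    then have "close_pair n x a b \<and> x i \<le> x a \<and> x b \<le> x j \<longleftrightarrow> close_pair n y a b \<and> y i \<le> y a \<and> y b \<le> y j" for a b
      using order[of a i] order[of j b] close_pair[of a b] by (auto simp: close_pair_def simp flip: not_less)
    then show ?thesis by (simp add: chain_arc_def close_pair)
  qed (auto simp: chain_arc_def close_pair_def)
  then have next_eq: "next_in_block n f = next_in_block n g"
    using x y by (auto simp: represents_def fun_eq_iff)
  have pos_eq: "pos {..<n} x i = pos {..<n} y i" if "i < n" for i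
    unfolding pos_def using order that by (intro arg_cong[of _ _ card]) auto
  have first: "first_in_block f i \<longleftrightarrow> first_in_block g i" if "i < n" for i
    using next_in_blockE[OF that] next_in_block_first next_eq by metis
  show "i < n \<Longrightarrow> f i = g i"
  proof (induction i rule: less_induct)
    case (less i)
    show ?case
    proof (cases "first_in_block f i")
      case True
      with first pos_eq x y less.prems show ?thesis by (auto simp: represents_def)
    next
      case False
      with less.prems obtain p where "next_in_block n f p i" by (auto elim: next_in_blockE)
      moreover from this have "next_in_block n g p i" by (simp add: next_eq)
      ultimately show ?thesis using less by (auto simp: next_in_block_def)
    qed
  qed
qed

section \<open>Constructing a point from a parking function\<close>

lemma ex_gap_above:
  fixes c :: real
  assumes "finite F"
  shows "\<exists>y>c. \<forall>v\<in>F. v \<le> c \<or> y < v"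
  using assms
proof (induction F)
  case empty
  show ?case by (rule exI[of _ "c + 1"]) simp
next
  case (insert v F)
  then obtain y where y: "c < y" "\<forall>v\<in>F. v \<le> c \<or> y < v" by blast
  show ?case
  proof (cases "v \<le> c")
    case True
    with y show ?thesis by auto
  next
    case False
    then show ?thesis using y by (intro exI[of _ "min y ((c + v) / 2)"]) (auto simp: min_less_iff_disj)
  qed
qed

text \<open>
  The last condition prevents an arc from ending in the first element \<open>j\<close> of a block: the pair formed by
  \<open>k\<close> and its predecessor, at \<open>x k + 1\<close>, contains every candidate.
\<close>

definition spaced :: "nat \<Rightarrow> (nat \<Rightarrow> nat) \<Rightarrow> nat set \<Rightarrow> (nat \<Rightarrow> real) \<Rightarrow> bool" where
  "spaced n f A x \<longleftrightarrow> inj_on x A \<and>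
     (\<forall>i j. j \<in> A \<and> next_in_block n f i j \<longrightarrow> x i = x j + 1) \<and>
     (\<forall>j\<in>A. first_in_block f j \<longrightarrow> f j = pos A x j) \<and>
     (\<forall>j\<in>A. first_in_block f j \<longrightarrow> (\<forall>i\<in>A. x j < x i \<and> x i \<le> x j + 1 \<longrightarrow>
       (\<exists>k\<in>A. \<not> first_in_block f k \<and> x k < x j \<and> x i \<le> x k + 1)))"

text \<open>Finds the place of the first element of the block with value \<open>p\<close>. The block
  will occupy \<open>y\<close>, \<open>y - 1\<close>, ...; the second conclusion keeps it off the
  values in use, and the third is what \<open>spaced\<close> demands of a first element at
  \<open>y\<close>.\<close>

lemma ex_block_position:
  assumes A: "finite A" "inj_on x A" "p \<le> card A"
    and first: "\<And>j. j \<in> A \<Longrightarrow> first_in_block f j \<Longrightarrow> pos A x j < p"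
  obtains y where "card {i \<in> A. y < x i} = p" "\<And>i r. i \<in> A \<Longrightarrow> r \<le> n \<Longrightarrow> y - real r \<noteq> x i"
    "\<And>i. i \<in> A \<Longrightarrow> y < x i \<Longrightarrow> x i \<le> y + 1 \<Longrightarrow>
       \<exists>k\<in>A. \<not> first_in_block f k \<and> x k < y \<and> x i \<le> x k + 1"
proof (cases "p = card A")
  case True
  \<comment> \<open>The offset 2 leaves no element within distance 1 above \<open>y\<close>, so the
    third conclusion holds vacuously.\<close>
  define y where "y = Min (x ` A) - 2"
  have y: "y < x i - 1" if "i \<in> A" for i
  proof -
    have "Min (x ` A) \<le> x i" using A(1) that by simp
    then show ?thesis unfolding y_def by linarith
  qed
  have "{i \<in> A. y < x i} = A" using y by force
  with True have "card {i \<in> A. y < x i} = p" by simp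
  moreover have "y - real r \<noteq> x i" if "i \<in> A" for i r
    using y[OF that] of_nat_0_le_iff[of r, where ?'a = real] by linarith
  ultimately show thesis using y that[of y] by fastforce
next
  case False
  with A(3) have "p < card A" by simp
  then obtain z where z: "z \<in> A" "pos A x z = p"
    using ex_pos[OF A(1,2)] by blast
  \<comment> \<open>Avoiding \<open>x i + real r\<close> keeps \<open>y - real r\<close> off the
    values in use. With \<open>x i - 1\<close> in the set, \<open>x i \<le> y + 1\<close> forces
    \<open>x i \<le> x z + 1\<close>, so \<open>z\<close> can serve as \<open>k\<close>; it is not
    first in its block, as first elements have positions below \<open>p\<close>.\<close>
  let ?F = "(\<lambda>(i, r). x i + real r) ` (A \<times> {..n}) \<union> (\<lambda>i. x i - 1) ` A"
  have "finite ?F" using A(1) by simp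
  from ex_gap_above[OF this, of "x z"] obtain y where y: "x z < y" "\<forall>v\<in>?F. v \<le> x z \<or> y < v" by blast
  have r: "x i + real r \<le> x z \<or> y < x i + real r" if "i \<in> A" "r \<le> n" for i r
  proof -
    have "x i + real r \<in> ?F" using that by (intro UnI1 image_eqI[of _ _ "(i, r)"]) auto
    with y(2) show ?thesis by (rule bspec)
  qed
  have one: "x i - 1 \<le> x z \<or> y < x i - 1" if "i \<in> A" for i
    using y(2) that by blast
  have "{i \<in> A. y < x i} = {i \<in> A. x z < x i}" using r[of _ 0] y(1) by fastforce
  then have "card {i \<in> A. y < x i} = p" using z(2) by (simp add: pos_def)
  moreover have "y - real k \<noteq> x i" if "i \<in> A" "k \<le> n" for i k
    using r[OF that] y(1) by auto
  moreover have "\<exists>k\<in>A. \<not> first_in_block f k \<and> x k < y \<and> x i \<le> x k + 1"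
    if "i \<in> A" "y < x i" "x i \<le> y + 1" for i
    using one[OF that(1)] that z first[of z] y(1) by (intro bexI[of _ z]) auto
  ultimately show thesis by (rule that)
qed

text \<open>
  The block of value \<open>p\<close> is inserted with its first element just above the element at position \<open>p\<close>, or far
  below everything if there is none.
\<close>

lemma spaced_step:
  assumes x: "spaced n f {i. i < n \<and> f i < p} x" and p: "p \<le> card {i. i < n \<and> f i < p}"
  shows "\<exists>x'. spaced n f {i. i < n \<and> f i < Suc p} x'"
proof -
  let ?A = "{i. i < n \<and> f i < p}" and ?A' = "{i. i < n \<and> f i < Suc p}"
  have inj: "inj_on x ?A"
    and nxt: "\<And>i j. j < n \<Longrightarrow> f j < p \<Longrightarrow> next_in_block n f i j \<Longrightarrow> x i = x j + 1"
    and first: "\<And>j. j \<in> ?A \<Longrightarrow> first_in_block f j \<Longrightarrow> f j = pos ?A x j"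
    and extra: "\<And>i j. j \<in> ?A \<Longrightarrow> i \<in> ?A \<Longrightarrow> first_in_block f j \<Longrightarrow> x j < x i \<Longrightarrow> x i \<le> x j + 1 \<Longrightarrow>
       \<exists>k\<in>?A. \<not> first_in_block f k \<and> x k < x j \<and> x i \<le> x k + 1"
    using x unfolding spaced_def by blast+
  have fin: "finite ?A" by simp
  have "pos ?A x j < p" if "j \<in> ?A" "first_in_block f j" for j
    using first[OF that] that(1) by simp
  from ex_block_position[where n = n, OF fin inj p this] obtain y
    where y1: "card {i \<in> ?A. y < x i} = p"
      and y2: "\<And>i r. i \<in> ?A \<Longrightarrow> r \<le> n \<Longrightarrow> y - real r \<noteq> x i"
      and y3: "\<And>i. i \<in> ?A \<Longrightarrow> y < x i \<Longrightarrow> x i \<le> y + 1 \<Longrightarrow>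
       \<exists>k\<in>?A. \<not> first_in_block f k \<and> x k < y \<and> x i \<le> x k + 1"
    by blast
  \<comment> \<open>The rank inside the new block, so that neighbours in the block differ by exactly
    1.\<close>
  define rank where "rank i = card {j. j < i \<and> f j = p}" for i
  define x' where "x' i = (if f i = p then y - real (rank i) else x i)" for i
  have rank_less: "rank i < rank j" if "i < j" "f i = p" for i j
    unfolding rank_def using that by (intro psubset_card_mono) auto
  have rank_le: "rank i \<le> n" if "i < n" for i
  proof -
    have "rank i \<le> card {..<i}" unfolding rank_def by (intro card_mono) auto
    with that show ?thesis by simp
  qed
  have rank_first: "rank j = 0" if "first_in_block f j" "f j = p" for j
    using that by (auto simp: rank_def first_in_block_def)
  have old: "x' i = x i" if "i \<in> ?A" for i using that by (simp add: x'_def)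
  have new: "x' i \<le> y" if "f i = p" for i using that by (simp add: x'_def)
  have cases': "i \<in> ?A' \<Longrightarrow> i \<in> ?A \<or> i < n \<and> f i = p" for i by auto
  have "inj_on x' ?A'"
  proof (rule inj_onI)
    fix i j assume ij: "i \<in> ?A'" "j \<in> ?A'" "x' i = x' j"
    show "i = j"
    proof (cases "f i = p"; cases "f j = p")
      assume "f i = p" "f j = p"
      with ij rank_less[of i j] rank_less[of j i] show ?thesis
        by (cases i j rule: linorder_cases) (auto simp: x'_def)
    next
      assume "f i = p" "f j \<noteq> p"
      with ij y2[of j "rank i"] rank_le[of i] show ?thesis by (auto simp: x'_def)
    next
      assume "f i \<noteq> p" "f j = p"
      with ij y2[of i "rank j"] rank_le[of j] show ?thesis by (auto simp: x'_def)
    next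
      assume "f i \<noteq> p" "f j \<noteq> p"
      with ij inj show ?thesis by (auto simp: x'_def dest: inj_onD)
    qed
  qed
  moreover have "x' i = x' j + 1" if "j \<in> ?A'" "next_in_block n f i j" for i j
  proof (cases "f j = p")
    case True
    then have "{k. k < j \<and> f k = p} = insert i {k. k < i \<and> f k = p}"
      using that(2) by (auto simp: next_in_block_def) (metis linorder_neqE_nat)
    then have "rank j = Suc (rank i)" by (simp add: rank_def)
    with True that(2) show ?thesis by (simp add: x'_def next_in_block_def)
  next
    case False
    with that nxt[of j i] show ?thesis by (auto simp: x'_def next_in_block_def)
  qed
  \<comment> \<open>The old first element \<open>j\<close> has fewer than \<open>p\<close> elements
    above it, whereas \<open>y\<close> has \<open>p\<close>. New values are at most
    \<open>y\<close>, so they leave its position unchanged.\<close>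
  moreover have above: "y < x j" if j: "j \<in> ?A" "first_in_block f j" for j
  proof (rule ccontr)
    assume "\<not> y < x j"
    then have "card {i \<in> ?A. y < x i} \<le> card {i \<in> ?A. x j < x i}"
      by (intro card_mono) auto
    with y1 first[OF j] j(1) show False by (simp add: pos_def)
  qed
  moreover have "f j = pos ?A' x' j" if j: "j \<in> ?A'" "first_in_block f j" for j
  proof (cases "f j = p")
    case True
    then have "x' j = y" using rank_first[OF j(2)] by (simp add: x'_def)
    then have "{i \<in> ?A'. x' j < x' i} = {i \<in> ?A. y < x i}"
      using new by (auto simp: x'_def less_Suc_eq)
    with True y1 show ?thesis by (simp add: pos_def)
  next
    case False
    with j have jA: "j \<in> ?A" by auto
    have "{i \<in> ?A'. x' j < x' i} = {i \<in> ?A. x j < x i}"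
      using new above[OF jA j(2)] old[OF jA] by (force simp: x'_def less_Suc_eq)
    with first[OF jA j(2)] show ?thesis by (simp add: pos_def)
  qed
  moreover have "\<exists>k\<in>?A'. \<not> first_in_block f k \<and> x' k < x' j \<and> x' i \<le> x' k + 1"
    if j: "j \<in> ?A'" "first_in_block f j" and i: "i \<in> ?A'" "x' j < x' i" "x' i \<le> x' j + 1" for i j
  proof -
    \<comment> \<open>All first elements are at \<open>y\<close> or higher and new values are at
      most \<open>y\<close>, so whatever lies above a first element is old.\<close>
    have yj: "y \<le> x' j"
      using cases'[OF j(1)] above[OF _ j(2)] old rank_first[OF j(2)] by (force simp: x'_def)
    have iA: "i \<in> ?A" using cases'[OF i(1)] new[of i] i(2) yj by auto
    have "\<exists>k\<in>?A. \<not> first_in_block f k \<and> x k < x' j \<and> x i \<le> x k + 1"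
    proof (cases "f j = p")
      case True
      then have "x' j = y" using rank_first[OF j(2)] by (simp add: x'_def)
      then show ?thesis using y3[OF iA] i old[OF iA] by simp
    next
      case False
      with j have jA: "j \<in> ?A" by auto
      show ?thesis using extra[OF jA iA j(2)] i old[OF iA] old[OF jA] by simp
    qed
    then obtain k where "k \<in> ?A" "\<not> first_in_block f k" "x k < x' j" "x i \<le> x k + 1" by blast
    then show ?thesis using old[OF iA] old[of k] by (intro bexI[of _ k]) auto
  qed
  ultimately have "spaced n f ?A' x'" unfolding spaced_def by blast
  then show ?thesis by blast
qed

text \<open>Blocks are inserted in order of increasing value. The counting hypothesis at
  \<open>k = p\<close> says that enough elements are present for the block with value
  \<open>p\<close> to start at position \<open>p\<close>.\<close>

lemma ex_represents_of_function:
  assumes "\<And>k. k \<le> n \<Longrightarrow> k \<le> card {i. i < n \<and> f i < k}"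
  shows "\<exists>x. represents n f x"
proof -
  have "\<exists>x. spaced n f {i. i < n \<and> f i < p} x" if "p \<le> n" for p
    using that
  proof (induction p)
    case 0
    show ?case by (simp add: spaced_def)
  next
    case (Suc p)
    then obtain x where "spaced n f {i. i < n \<and> f i < p} x" by auto
    then show ?case using Suc.prems assms[of p] by (intro spaced_step) auto
  qed
  moreover have "{i. i < n \<and> f i < n} = {..<n}"
    by (rule card_seteq) (use assms[of n] in auto)
  ultimately obtain x where "spaced n f {..<n} x" by (metis order_refl)
  then have inj: "inj_on x {..<n}"
    and nxt': "\<And>i j. j \<in> {..<n} \<Longrightarrow> next_in_block n f i j \<Longrightarrow> x i = x j + 1"
    and first: "\<And>j. j \<in> {..<n} \<Longrightarrow> first_in_block f j \<Longrightarrow> f j = pos {..<n} x j"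
    and extra: "\<And>i j. j \<in> {..<n} \<Longrightarrow> i \<in> {..<n} \<Longrightarrow> first_in_block f j \<Longrightarrow> x j < x i \<Longrightarrow>
       x i \<le> x j + 1 \<Longrightarrow> \<exists>k\<in>{..<n}. \<not> first_in_block f k \<and> x k < x j \<and> x i \<le> x k + 1"
    unfolding spaced_def by blast+
  have nxt: "x i = x j + 1" if "next_in_block n f i j" for i j
    using nxt'[OF _ that] that by (simp add: next_in_block_def)
  have eqI: "i = j" if "x i = x j" "i < n" "j < n" for i j
    using inj that by (auto dest: inj_onD)
  have nxt_close: "close_pair n x i j" if "next_in_block n f i j" for i j
    using nxt[OF that] that by (auto simp: close_pair_def next_in_block_def)
  have "chain_arc n x i j \<longleftrightarrow> next_in_block n f i j" for i j
  proof
    assume b: "next_in_block n f i j"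
    have "a = i \<and> b = j" if "close_pair n x a b" "x i \<le> x a" "x b \<le> x j" for a b
    proof -
      \<comment> \<open>A close pair has length at most 1, which is already the length of this
        one.\<close>
      have "x a = x i" "x b = x j" using nxt[OF b] that by (auto simp: close_pair_def)
      with that b show ?thesis by (auto simp: close_pair_def next_in_block_def intro!: eqI)
    qed
    with nxt_close[OF b] show "chain_arc n x i j" by (auto simp: chain_arc_def)
  next
    assume a: "chain_arc n x i j"
    then have ij: "i < j" "j < n" "x j < x i" "x i \<le> x j + 1" by (auto simp: chain_arc_def close_pair_def)
    \<comment> \<open>The pair of \<open>k\<close> and its predecessor has length 1 and contains the
      arc, so by maximality it is the arc. If \<open>j\<close> is not first in its block,
      \<open>k = j\<close> serves.\<close>
    have "\<exists>k<n. \<not> first_in_block f k \<and> x k \<le> x j \<and> x i \<le> x k + 1"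
    proof (cases "first_in_block f j")
      case True
      with extra[of j i] ij show ?thesis by fastforce
    qed (use ij in auto)
    then obtain k where k: "k < n" "\<not> first_in_block f k" "x k \<le> x j" "x i \<le> x k + 1" by blast
    then obtain p where p: "next_in_block n f p k" using next_in_blockE by blast
    have "close_pair n x p k \<and> x i \<le> x p \<and> x k \<le> x j" using nxt_close[OF p] nxt[OF p] k by simp
    with a have "p = i \<and> k = j" unfolding chain_arc_def by blast
    with p show "next_in_block n f i j" by simp
  qed
  then have "represents n f x" using inj first by (auto simp: represents_def fun_eq_iff)
  then show ?thesis by blast
qed

section \<open>Regions of the Shi arrangement\<close>

definition patterns :: "nat \<Rightarrow> (nat \<times> nat) set set" where
  "patterns n = {pattern n x | x. inj_on x {..<n}}"

lemma parking_function_counts: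
  assumes "length a = n" "\<forall>k\<in>set a. 1 \<le> k"
  shows "a \<in> parking_functions n \<longleftrightarrow> (\<forall>k\<le>n. k \<le> card {i. i < n \<and> a ! i - 1 < k})"
proof -
  have "size {#x \<in># mset a. x \<le> k#} = card {i. i < n \<and> a ! i - 1 < k}" for k
  proof -
    have "size {#x \<in># mset a. x \<le> k#} = card {i. i < n \<and> a ! i \<le> k}"
      using assms(1) by (simp add: length_filter_conv_card flip: mset_filter)
    moreover have "a ! i \<le> k \<longleftrightarrow> a ! i - 1 < k" if "i < n" for i
      using assms that nth_mem[of i a] by fastforce
    ultimately show ?thesis by (metis (mono_tags, lifting) Collect_cong)
  qed
  moreover have "0 \<notin> set a" using assms(2) by force
  ultimately show ?thesis using assms(1) by (simp add: parking_functions_iff parking_mset_def)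
qed

lemma represents_cong:
  assumes "\<And>i. i < n \<Longrightarrow> f i = g i" "represents n f x"
  shows "represents n g x"
proof -
  have "next_in_block n f i j \<longleftrightarrow> next_in_block n g i j" for i j
    using assms(1) by (auto simp: next_in_block_def)
  then have "next_in_block n f = next_in_block n g" by blast
  moreover have "first_in_block g i \<longleftrightarrow> first_in_block f i" if "i < n" for i
    using assms(1) that by (auto simp: first_in_block_def)
  ultimately show ?thesis using assms by (simp add: represents_def)
qed

text \<open>A parking function is sent to the pattern of some point representing it; by
  \<open>represents_pattern_eq\<close> the chosen point does not matter. For surjectivity, a point
  yields its own function, and the point chosen for that function has the same pattern.\<close>

lemma ex_bij_betw_patterns: "\<exists>h. bij_betw h (parking_functions n) (patterns n)"
proof -
  define X where "X a = (SOME x. represents n (\<lambda>i. a ! i - 1) x)" for a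
  have pf: "length a = n" "\<forall>k\<in>set a. 1 \<le> k" if "a \<in> parking_functions n" for a
    using that by (auto simp: parking_functions_def)
  have X: "represents n (\<lambda>i. a ! i - 1) (X a)" if "a \<in> parking_functions n" for a
  proof -
    have "\<exists>x. represents n (\<lambda>i. a ! i - 1) x"
      using parking_function_counts[OF pf[OF that]] that by (intro ex_represents_of_function) simp
    then show ?thesis unfolding X_def by (rule someI_ex)
  qed
  have "inj_on (\<lambda>a. pattern n (X a)) (parking_functions n)"
  proof (rule inj_onI)
    fix a b assume ab: "a \<in> parking_functions n" "b \<in> parking_functions n" "pattern n (X a) = pattern n (X b)"
    have "a ! i = b ! i" if "i < n" for i
    proof -
      have "a ! i - 1 = b ! i - 1" using represents_unique[OF X[OF ab(1)] X[OF ab(2)] ab(3) that] .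
      moreover have "1 \<le> a ! i" "1 \<le> b ! i" using pf ab that by (metis nth_mem)+
      ultimately show ?thesis by simp
    qed
    then show "a = b" using pf ab by (simp add: list_eq_iff_nth_eq)
  qed
  moreover have "(\<lambda>a. pattern n (X a)) ` parking_functions n = patterns n"
  proof
    show "(\<lambda>a. pattern n (X a)) ` parking_functions n \<subseteq> patterns n"
      using X by (auto simp: patterns_def represents_def)
    show "patterns n \<subseteq> (\<lambda>a. pattern n (X a)) ` parking_functions n"
    proof
      fix B assume "B \<in> patterns n"
      then obtain x where x: "B = pattern n x" "inj_on x {..<n}" by (auto simp: patterns_def)
      from ex_represents_of_point[OF x(2)] obtain f
        where f: "represents n f x" "\<And>k. k \<le> n \<Longrightarrow> k \<le> card {i. i < n \<and> f i < k}" by blast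
      define a where "a = map (\<lambda>i. f i + 1) [0..<n]"
      have ai: "a ! i - 1 = f i" if "i < n" for i using that by (simp add: a_def)
      have "{i. i < n \<and> a ! i - 1 < k} = {i. i < n \<and> f i < k}" for k using ai by auto
      moreover have "length a = n" "\<forall>k\<in>set a. 1 \<le> k" by (auto simp: a_def)
      ultimately have a: "a \<in> parking_functions n" using f(2) by (simp add: parking_function_counts)
      have "represents n (\<lambda>i. a ! i - 1) x" by (rule represents_cong[OF _ f(1)]) (rule ai[symmetric])
      from represents_pattern_eq[OF this X[OF a]] x(1) have "B = pattern n (X a)" by simp
      with a show "B \<in> (\<lambda>a. pattern n (X a)) ` parking_functions n" by blast
    qed
  qed
  ultimately show ?thesis unfolding bij_betw_def by blast
qed

section \<open>Connected components as classes of equal sign pattern\<close>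

definition shi_complement :: "nat \<Rightarrow> (nat \<Rightarrow> real) set" where
  "shi_complement n = {x. (\<forall>i\<ge>n. x i = 0) \<and> (\<forall>i j. i < j \<and> j < n \<longrightarrow> x i \<noteq> x j \<and> x i \<noteq> x j + 1)}"

lemma topspace_shi_complement:
  "topspace (subtopology (Euclidean_space n) (- \<Union>(shi_arrangement n))) = shi_complement n"
proof -
  have mem: "x \<in> \<Union>(shi_arrangement n) \<longleftrightarrow>
      (\<forall>i\<ge>n. x i = 0) \<and> (\<exists>i j. i < j \<and> j < n \<and> (x i = x j \<or> x i = x j + 1))" for x
  proof -
    have "x i - x j \<in> {0, 1} \<longleftrightarrow> x i = x j \<or> x i = x j + 1" for i j by auto
    moreover have "x \<in> \<Union>(shi_arrangement n) \<longleftrightarrow>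
        (\<forall>i\<ge>n. x i = 0) \<and> (\<exists>i j. i < j \<and> j < n \<and> x i - x j \<in> {0, 1})"
      unfolding shi_arrangement_def topspace_Euclidean_space by blast
    ultimately show ?thesis by simp
  qed
  show ?thesis
    by (rule set_eqI, simp only: topspace_subtopology Int_iff Compl_iff mem topspace_Euclidean_space
        mem_Collect_eq shi_complement_def) blast
qed

text \<open>\<open>Euclidean_space n\<close> carries the subspace topology of the product topology,
  which is the type class topology on functions, so \<open>connected\<close> and its continuity
  lemmas apply.\<close>

lemma connectedin_shi_complement:
  "connectedin (subtopology (Euclidean_space n) (- \<Union>(shi_arrangement n))) S \<longleftrightarrow>
     connected S \<and> S \<subseteq> shi_complement n"
proof -
  have "connectedin (subtopology (Euclidean_space n) (- \<Union>(shi_arrangement n))) S \<longleftrightarrow>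
      connected S \<and> S \<subseteq> {x. \<forall>i\<ge>n. x i = 0} \<inter> (- \<Union>(shi_arrangement n))"
    by (simp add: Euclidean_space_def connectedin_subtopology euclidean_product_topology)
  moreover have "{x. \<forall>i\<ge>n. x i = 0} \<inter> (- \<Union>(shi_arrangement n)) = shi_complement n"
    using topspace_shi_complement[of n] by (simp add: topspace_Euclidean_space)
  ultimately show ?thesis by simp
qed

lemma shi_complement_pattern:
  assumes "x \<in> shi_complement n" "i < n" "j < n" "i \<noteq> j"
  shows "(j, i) \<in> pattern n x \<longleftrightarrow> (if j < i then 1 else 0) < x j - x i"
    "x j - x i \<noteq> (if j < i then 1 else 0)"
proof -
  show "(j, i) \<in> pattern n x \<longleftrightarrow> (if j < i then 1 else 0) < x j - x i"
    using assms by (auto simp: pattern_def)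
  have "x a \<noteq> x b \<and> x a \<noteq> x b + 1" if "a < b" "b < n" for a b
    using assms(1) that by (simp add: shi_complement_def)
  from this[of i j] this[of j i] show "x j - x i \<noteq> (if j < i then 1 else 0)"
    using assms(2-4) by (cases i j rule: linorder_cases) auto
qed

text \<open>On a connected set a coordinate difference cannot pass a value that it avoids, so the
  pattern is constant. Conversely, the segment between two points of equal pattern stays on one side
  of every hyperplane.\<close>

lemma connected_component_shi_iff:
  assumes x: "x \<in> shi_complement n" and y: "y \<in> shi_complement n"
  shows "connected_component_of (subtopology (Euclidean_space n) (- \<Union>(shi_arrangement n))) x y \<longleftrightarrow>
    pattern n x = pattern n y"
proof
  assume "connected_component_of (subtopology (Euclidean_space n) (- \<Union>(shi_arrangement n))) x y"
  then obtain S where S: "connected S" "S \<subseteq> shi_complement n" "x \<in> S" "y \<in> S"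
    by (auto simp: connected_component_of_def connectedin_shi_complement)
  have imp: "(j, i) \<in> pattern n v" if u: "u \<in> S" and v: "v \<in> S" and "(j, i) \<in> pattern n u" for i j u v
  proof -
    from that have ij: "i < n" "j < n" "i \<noteq> j" by (auto simp: pattern_def)
    define c :: real where "c = (if j < i then 1 else 0)"
    let ?g = "\<lambda>z :: nat \<Rightarrow> real. z j - z i"
    have side: "(j, i) \<in> pattern n z \<longleftrightarrow> c < ?g z" "?g z \<noteq> c" if "z \<in> S" for z
      using shi_complement_pattern[OF _ ij] that S(2) by (auto simp: c_def)
    have "continuous_on S ?g"
      by (intro continuous_on_diff continuous_on_subset[OF continuous_on_product_coordinates]) auto
    then have conn: "connected (?g ` S)" using S(1) by (rule connected_continuous_image)
    show ?thesis
    proof (rule ccontr)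
      assume "(j, i) \<notin> pattern n v"
      then have c: "c \<in> {?g v..?g u}"
        using side(1)[OF u] side(1)[OF v] that(3) by simp
      have "{?g v..?g u} \<subseteq> ?g ` S"
        using u v by (intro connected_contains_Icc[OF conn] imageI)
      with c obtain z where "z \<in> S" "c = ?g z" by blast
      with side(2) show False by blast
    qed
  qed
  show "pattern n x = pattern n y"
    using imp S(3,4) by auto
next
  assume eq: "pattern n x = pattern n y"
  let ?p = "\<lambda>t k. (1 - t) * x k + t * y k :: real"
  have "connected (?p ` {0..1})"
    by (intro connected_continuous_image continuous_on_coordinatewise_then_product continuous_intros) auto
  moreover have "?p t \<in> shi_complement n" if t: "t \<in> {0..1}" for t
  proof -
    have *: "?p t j - ?p t i \<noteq> (if j < i then 1 else 0)" if ij: "i < n" "j < n" "i \<noteq> j" for i j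
    proof -
      define c :: real where "c = (if j < i then 1 else 0)"
      note px = shi_complement_pattern[OF x ij, folded c_def]
        and py = shi_complement_pattern[OF y ij, folded c_def]
      \<comment> \<open>The deviation from the hyperplane is affine in \<open>t\<close>, and its
        values at the two ends have the same sign.\<close>
      have diff: "?p t j - ?p t i - c = (1 - t) * (x j - x i - c) + t * (y j - y i - c)"
        by (simp add: algebra_simps)
      have convex: "0 < (1 - t) * a + t * b" if "0 < a" "0 < b" for a b :: real
      proof (cases "t = 0")
        case False
        with t that have "0 \<le> (1 - t) * a" "0 < t * b" by auto
        then show ?thesis by linarith
      qed (use that in simp)
      have "?p t j - ?p t i - c \<noteq> 0"
      proof (cases "(j, i) \<in> pattern n x")
        case True
        then have "0 < x j - x i - c" "0 < y j - y i - c" using px(1) py(1) eq by auto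
        from convex[OF this] diff show ?thesis by linarith
      next
        case False
        then have "0 < - (x j - x i - c)" "0 < - (y j - y i - c)" using px py eq by auto
        from convex[OF this] have "0 < - ((1 - t) * (x j - x i - c) + t * (y j - y i - c))"
          by (simp only: mult_minus_right minus_add_distrib)
        with diff show ?thesis by linarith
      qed
      then show ?thesis by (simp add: c_def)
    qed
    have "?p t i \<noteq> ?p t j \<and> ?p t i \<noteq> ?p t j + 1" if "i < j" "j < n" for i j
      using *[of i j] *[of j i] that by auto
    moreover have "?p t i = 0" if "n \<le> i" for i
      using x y that by (simp add: shi_complement_def)
    ultimately show ?thesis by (simp add: shi_complement_def)
  qed
  moreover have "x = ?p 0" "y = ?p 1" by auto
  ultimately show "connected_component_of (subtopology (Euclidean_space n) (- \<Union>(shi_arrangement n))) x y"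
    unfolding connected_component_of_def connectedin_shi_complement
    by (intro exI[of _ "?p ` {0..1}"]) (auto intro: image_eqI[of _ _ 0] image_eqI[of _ _ 1])
qed

text \<open>Shrinking a point slightly moves it off the hyperplanes \<open>x\<^sub>i - x\<^sub>j = 1\<close> and keeps its pattern.\<close>

lemma pattern_shi_complement: "pattern n ` shi_complement n = patterns n"
proof
  have "inj_on x {..<n}" if "x \<in> shi_complement n" for x
  proof (rule inj_onI)
    fix i j assume ij: "i \<in> {..<n}" "j \<in> {..<n}" "x i = x j"
    have "x a \<noteq> x b" if "a < b" "b < n" for a b
      using \<open>x \<in> shi_complement n\<close> that by (simp add: shi_complement_def)
    from this[of i j] this[of j i] ij show "i = j" by (cases i j rule: linorder_cases) auto
  qed
  then show "pattern n ` shi_complement n \<subseteq> patterns n" by (auto simp: patterns_def)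
  show "patterns n \<subseteq> pattern n ` shi_complement n"
  proof
    fix B assume "B \<in> patterns n"
    then obtain x where x: "B = pattern n x" "inj_on x {..<n}" by (auto simp: patterns_def)
    let ?F = "(\<lambda>(i, j). x i - x j) ` ({..<n} \<times> {..<n})"
    have "finite ?F" by simp
    \<comment> \<open>\<open>c\<close> lies between 1 and all differences exceeding 1. After
      division by \<open>c\<close> these still exceed 1, and all others fall strictly below
      1.\<close>
    from ex_gap_above[OF this, of 1] obtain c where c: "1 < c" "\<forall>v\<in>?F. v \<le> 1 \<or> c < v" by blast
    have gap: "x i - x j \<le> 1 \<or> c < x i - x j" if "i < n" "j < n" for i j
    proof -
      have "x i - x j \<in> ?F" using that by (intro image_eqI[of _ _ "(i, j)"]) auto
      with c(2) show ?thesis by (rule bspec)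
    qed
    define y where "y i = (if i < n then x i / c else 0)" for i
    have diff: "y i - y j = (x i - x j) / c" if "i < n" "j < n" for i j
      using that by (simp add: y_def diff_divide_distrib)
    have one: "1 < y i - y j \<longleftrightarrow> 1 < x i - x j" "y i - y j \<noteq> 1" if "i < n" "j < n" for i j
      using gap[OF that] c(1) by (auto simp: diff[OF that] less_divide_eq divide_eq_eq)
    have zero: "0 < y i - y j \<longleftrightarrow> 0 < x i - x j" "y i - y j = 0 \<longleftrightarrow> x i - x j = 0" if "i < n" "j < n" for i j
      using c(1) by (auto simp: diff[OF that] zero_less_divide_iff)
    have "(j, i) \<in> pattern n x \<longleftrightarrow> (j, i) \<in> pattern n y" for i j
      using one(1)[of j i] zero(1)[of j i] by (auto simp: pattern_def algebra_simps)
    then have "pattern n x = pattern n y" by auto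
    moreover have "y i = 0" if "n \<le> i" for i using that by (simp add: y_def)
    moreover have "y i \<noteq> y j \<and> y i \<noteq> y j + 1" if "i < j" "j < n" for i j
    proof -
      have "x i \<noteq> x j" using x(2) that by (auto dest: inj_onD)
      with one(2)[of i j] zero(2)[of i j] that show ?thesis by auto
    qed
    ultimately have "pattern n x = pattern n y" "y \<in> shi_complement n"
      by (simp_all add: shi_complement_def)
    then show "B \<in> pattern n ` shi_complement n" using x(1) by blast
  qed
qed

lemma ex_bij_betw_images:
  assumes "\<And>x y. x \<in> U \<Longrightarrow> y \<in> U \<Longrightarrow> g x = g y \<longleftrightarrow> h x = h y"
  shows "\<exists>k. bij_betw k (g ` U) (h ` U)"
proof -
  have inv: "inv_into U g (g x) \<in> U" "g (inv_into U g (g x)) = g x" if "x \<in> U" for x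
    using that by (auto simp: inv_into_into f_inv_into_f)
  have "bij_betw (\<lambda>z. h (inv_into U g z)) (g ` U) (h ` U)"
    unfolding bij_betw_def
  proof
    show "inj_on (\<lambda>z. h (inv_into U g z)) (g ` U)"
      using inv assms by (auto intro!: inj_onI)
    have "h (inv_into U g (g x)) = h x" if "x \<in> U" for x
      using inv[OF that] assms that by blast
    then show "(\<lambda>z. h (inv_into U g z)) ` g ` U = h ` U" by force
  qed
  then show ?thesis by blast
qed

lemma ex_bij_betw_shi_regions: "\<exists>\<phi>. bij_betw \<phi> (shi_regions n) (parking_functions n)"
proof -
  let ?X = "subtopology (Euclidean_space n) (- \<Union>(shi_arrangement n))"
  have regions: "shi_regions n = connected_component_of_set ?X ` shi_complement n"
    unfolding shi_regions_def connected_components_of_def topspace_shi_complement ..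
  have "connected_component_of_set ?X x = connected_component_of_set ?X y \<longleftrightarrow> pattern n x = pattern n y"
    if "x \<in> shi_complement n" "y \<in> shi_complement n" for x y
  proof -
    have "connected_component_of_set ?X x = connected_component_of_set ?X y \<longleftrightarrow>
        connected_component_of ?X x = connected_component_of ?X y"
      by (auto simp: fun_eq_iff set_eq_iff)
    also have "\<dots> \<longleftrightarrow> connected_component_of ?X x y"
      using connected_component_of_equiv[of ?X x y] that
      by (simp only: topspace_shi_complement simp_thms)
    finally show ?thesis using connected_component_shi_iff[OF that] by simp
  qed
  from ex_bij_betw_images[of "shi_complement n" "connected_component_of_set ?X" "pattern n", OF this]
  obtain k where "bij_betw k (shi_regions n) (patterns n)"
    unfolding regions pattern_shi_complement by blast
  moreover obtain h where "bij_betw h (parking_functions n) (patterns n)"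
    using ex_bij_betw_patterns by blast
  ultimately show ?thesis using bij_betw_trans bij_betw_inv_into by blast
qed

text \<open>All bijections give isomorphic actions, so the identity is stated for every one of them;
  the first conjunct keeps it from being vacuous.\<close>

theorem theorem1p9:
  fixes n :: nat
  assumes "n \<ge> 1"
  shows "(\<exists>\<phi>. bij_betw \<phi> (shi_regions n) (parking_functions n)) \<and>
    (\<forall>\<phi>. bij_betw \<phi> (shi_regions n) (parking_functions n) \<longrightarrow>
      frobenius_char_action n (shi_regions n)
        (transport_action (shi_regions n) \<phi> parking_action)
      = tree_series n 1 1 1 0)"
  using ex_bij_betw_shi_regions frobenius_char_parking_action by blast

end
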